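(* Assume that $(\overline{\widehat{K}}(X)|K,v)$ is an extension of valued fields, where $\widehat{K}$ is the completion of $(K,v)$, such that $(\widehat{K}(X)|\widehat{K},v)$ is valuation transcendental with a unique pair of definition $(a,\gamma)$ over $\widehat{K}$. After identifying equivalent valuations, assume that $v\overline{\widehat{K}}(X)=(\mathbb{Z}\oplus v\overline{K})_{\mathrm{lex}}$, where $\gamma=(1,0)$ and $\alpha\in v\overline{K}$ is identified with $(0,\alpha)$. Then: (i) If $a\in\overline{K}$, then $(\widehat{K}(X)|\widehat{K},v)$ is induced by the valuation transcendental extension $(K(X)|K,v)$. (ii) If $a\in\overline{\widehat{K}}\setminus\overline{K}$, then $(\widehat{K}(X)|\widehat{K},v)$ is induced by the valuation algebraic extension $(K(X)|K,v)$. Moreover, if $\{\gamma_\nu\}_{\nu<\lambda}$ is a cofinal well-ordered subset of $v(X-\overline{K})$ and $\{a_\nu\}_{\nu<\lambda}\subseteq\overline{K}$ is such that $v(X-a_\nu)=\gamma_\nu$ for all $\nu<\lambda$, then $\{a_\nu\}_{\nu<\lambda}$ is a Cauchy sequence in $(\overline{K},v)$ with $a$ as a limit. (Part of the assertion is that $(K(X)|K,v)$ is valuation transcendental in case (i) and valuation algebraic in case (ii).)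
   Context: Valuations are Krull valuations written additively; $vL$, $Lv$ denote value group and residue field. $(K,v)$ is dense in $(L,v)$ if for every $a\in L$, $\gamma\in vL$ there is $b\in K$ with $v(a-b)>\gamma$; the completion $(\widehat{K},v)$ is the maximal extension in which $(K,v)$ is dense. "An extension of valued fields $(\overline{\widehat{K}}(X)|K,v)$" means a valuation $v$ on $\overline{\widehat{K}}(X)$ ($\overline{\widehat{K}}\supseteq\overline{K}$ the algebraic closure of $\widehat{K}$) whose restriction to $\widehat{K}$ is the valuation of the completion; all subfields carry the restricted valuation. One has $v\overline{\widehat{K}}=v\overline{K}$. Write $v(X-\overline{K}):=\{v(X-c)\mid c\in\overline{K}\}$; sequences $\{\gamma_\nu\}_{\nu<\lambda}$ are strictly increasing with $\lambda$ a limit ordinal. Valuations $v_1,v_2$ on $F$ are equivalent if $v_2=\phi\circ v_1$ for an order preserving isomorphism $\phi:v_1F\to v_2F$. $(F(X)|F,v)$ is value transcendental if $\dim_{\mathbb{Q}}\big((vF(X)/vF)\otimes\mathbb{Q}\big)=1$, residue transcendental if $\mathrm{trdeg}[F(X)v:Fv]=1$, valuation transcendental if it is one of these, and valuation algebraic otherwise. For $a\in\overline{F}$ and $\gamma$ in an ordered abelian group containing $v\overline{F}$, $v_{a,\gamma}$ is the valuation on $\overline{F}(X)$ with $v_{a,\gamma}\big(\sum C_i(X-a)^i\big)=\min_i\{vC_i+i\gamma\}$. A pair $(a,\gamma)\in\overline{F}\times v\overline{F}(X)$ is a pair of definition for $v$ over $F$ if $v=v_{a,\gamma}$ on $\overline{F}(X)$.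 A sequence $\{z_\nu\}_{\nu<\lambda}$ is a pseudo-Cauchy sequence (pCs) if $v(z_{\nu_1}-z_{\nu_2})<v(z_{\nu_2}-z_{\nu_3})$ for $\nu_1<\nu_2<\nu_3$; $y$ is a limit if $v(y-z_\nu)=v(z_\nu-z_{\nu+1})$ for all $\nu$; a pCs in $(F,v)$ is a Cauchy sequence if the values $v(z_\nu-z_{\nu+1})$ are cofinal in $vF$. "$(\widehat{K}(X)|\widehat{K},v)$ is induced by $(K(X)|K,v)$" means that $v|_{\widehat{K}(X)}$ is, up to equivalence, the restriction of the following valuation on $\overline{\widehat{K}}(X)$ constructed from $v|_{\overline{\widehat{K}}}$ and $v|_{\overline{K}(X)}$ (independent of choices): (1) if $(K(X)|K,v)$ is valuation transcendental, the valuation $v_{b,\beta}$ formed from $v|_{\overline{\widehat{K}}}$, for a pair of definition $(b,\beta)$ of $v|_{\overline{K}(X)}$ over $K$; (2) if $(K(X)|K,v)$ is valuation algebraic, take a strictly increasing cofinal sequence $\{\gamma_\nu\}_{\nu<\lambda}$ in $v(X-\overline{K})$ and $a_\nu\in\overline{K}$ with $v(X-a_\nu)=\gamma_\nu$; if the pCs $\{a_\nu\}$ has a limit $b\in\overline{\widehat{K}}$, the valuation is $v_{b,\beta}$ with $\beta=(1,0)\in(\mathbb{Z}\oplus v\overline{K})_{\mathrm{lex}}$; otherwise it is the unique extension of $v|_{\overline{\widehat{K}}}$ to $\overline{\widehat{K}}(X)$ for which $X$ is a limit of $\{a_\nu\}$. *)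

theory Defs
  imports
    "HOL-Algebra.Algebraic_Closure_Type"
    "HOL-Algebra.Generated_Fields"
    "HOL-Computational_Algebra.Computational_Algebra"
    "HOL-Library.Extended"
    "HOL-Library.Poly_Mapping"
    "HOL-Library.Product_Plus"
    "HOL-Library.Product_Lexorder"
begin

section \<open>Ordered groups\<close>

text \<open>With \<^theory>\<open>HOL-Library.Product_Lexorder\<close>, the type \<open>int \<times> 'g\<close> is the
  lexicographically ordered group of which \<open>(\<int> \<oplus> G)\<^sub>l\<^sub>e\<^sub>x\<close> is the subgroup \<open>UNIV \<times> G\<close>.\<close>

instance prod :: (linordered_ab_group_add, linordered_ab_group_add) linordered_ab_group_add
  by standard (auto simp: less_eq_prod_def)

definition ordered_group_iso ::
  "('g::linordered_ab_group_add \<Rightarrow> 'h::linordered_ab_group_add) \<Rightarrow> 'g set \<Rightarrow> 'h set \<Rightarrow> bool" where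
  "ordered_group_iso \<phi> G H \<longleftrightarrow>
     bij_betw \<phi> G H \<and> (\<forall>x\<in>G. \<forall>y\<in>G. \<phi> (x + y) = \<phi> x + \<phi> y) \<and> strict_mono_on G \<phi>"


section \<open>Fields, valuations, completions\<close>

text \<open>A subset of a type of class \<^class>\<open>comm_ring_1\<close>, seen as a ring with the operations of the type.\<close>

definition ring_on :: "'f::comm_ring_1 set \<Rightarrow> 'f ring" where
  "ring_on S = ring_of_type_algebra\<lparr>carrier := S\<rparr>"

definition is_subfield :: "'f::field set \<Rightarrow> bool" where
  "is_subfield F \<longleftrightarrow> subfield F (ring_of_type_algebra :: 'f ring)"

text \<open>The relative algebraic closure of \<open>F\<close> in the ambient field, hence an algebraic closure of \<open>F\<close>
  when the ambient field is algebraically closed.\<close>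

definition alg_cl :: "'f::field set \<Rightarrow> 'f set" where
  "alg_cl F = {x. \<exists>p. p \<noteq> 0 \<and> (\<forall>i. poly.coeff p i \<in> F) \<and> poly p x = 0}"

text \<open>Krull valuations, additively, with \<open>v 0 = \<infinity>\<close>. The type \<^typ>\<open>'g extended\<close> also has an element
  \<open>-\<infinity>\<close>, which is excluded as a value.\<close>

definition valuation ::
  "('f, 'm) ring_scheme \<Rightarrow> ('f \<Rightarrow> 'g::linordered_ab_group_add extended) \<Rightarrow> bool" where
  "valuation R v \<longleftrightarrow>
     (\<forall>x\<in>carrier R. v x \<noteq> Minf) \<and>
     (\<forall>x\<in>carrier R. v x = Pinf \<longleftrightarrow> x = \<zero>\<^bsub>R\<^esub>) \<and>
     (\<forall>x\<in>carrier R. \<forall>y\<in>carrier R. v (x \<otimes>\<^bsub>R\<^esub> y) = v x + v y) \<and>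
     (\<forall>x\<in>carrier R. \<forall>y\<in>carrier R. min (v x) (v y) \<le> v (x \<oplus>\<^bsub>R\<^esub> y))"

definition value_group ::
  "'f set \<Rightarrow> ('f \<Rightarrow> 'g::linordered_ab_group_add extended) \<Rightarrow> 'g set" where
  "value_group F v = {\<gamma>. \<exists>x\<in>F. v x = Fin \<gamma>}"

definition equivalent_on ::
  "'f set \<Rightarrow> ('f \<Rightarrow> 'g::linordered_ab_group_add extended)
     \<Rightarrow> ('f \<Rightarrow> 'h::linordered_ab_group_add extended) \<Rightarrow> bool" where
  "equivalent_on F v w \<longleftrightarrow>
     (\<exists>\<phi>. ordered_group_iso \<phi> (value_group F v) (value_group F w) \<and>
          (\<forall>x\<in>F. w x = map_extended \<phi> (v x)))"

definition dense_in ::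
  "('f, 'm) ring_scheme \<Rightarrow> 'f set \<Rightarrow> ('f \<Rightarrow> 'g::linordered_ab_group_add extended) \<Rightarrow> bool" where
  "dense_in L K v \<longleftrightarrow>
     (\<forall>a\<in>carrier L. \<forall>\<gamma>\<in>value_group (carrier L) v. \<exists>b\<in>K. Fin \<gamma> < v (a \<ominus>\<^bsub>L\<^esub> b))"

text \<open>\<open>(Khat, v)\<close> is a completion of \<open>(K, v)\<close>: a maximal extension in which \<open>(K, v)\<close> is dense.
  Maximality ranges over all valued fields \<open>M\<close>, with an embedding \<open>\<iota>\<close> of \<open>(Khat, v)\<close>, whose elements
  are of type \<^typ>\<open>'g \<Rightarrow> 'f\<close> and whose values are in \<^typ>\<open>'g\<close>. Up to isomorphism this is every extension
  of \<open>(Khat, v)\<close> in which \<open>(K, v)\<close> is dense: density forces the value groups to be the same, and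
  \<open>y\<close> in the extension is determined by any function sending \<open>\<gamma>\<close> in the value group to some
  \<open>b \<in> K\<close> with \<open>v (y - b) > \<gamma>\<close>.\<close>

definition is_completion ::
  "'f::field set \<Rightarrow> 'f set \<Rightarrow> ('f \<Rightarrow> 'g::linordered_ab_group_add extended) \<Rightarrow> bool" where
  "is_completion K Khat v \<longleftrightarrow>
     is_subfield K \<and> is_subfield Khat \<and> K \<subseteq> Khat \<and>
     valuation (ring_on Khat) v \<and> dense_in (ring_on Khat) K v \<and>
     (\<forall>(M :: ('g \<Rightarrow> 'f) ring) w (\<iota> :: 'f \<Rightarrow> 'g \<Rightarrow> 'f).
        field M \<and> valuation M (w :: ('g \<Rightarrow> 'f) \<Rightarrow> 'g extended) \<and>
        \<iota> \<in> ring_hom (ring_on Khat) M \<and> (\<forall>x\<in>Khat. w (\<iota> x) = v x) \<and> dense_in M (\<iota> ` K) w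
        \<longrightarrow> \<iota> ` Khat = carrier M)"


section \<open>The rational function field\<close>

abbreviation cst :: "'f::field \<Rightarrow> 'f poly fract" where
  "cst c \<equiv> Fract [:c:] 1"

abbreviation XX :: "'f::field poly fract" where
  "XX \<equiv> Fract [:0, 1:] 1"

definition ratfuns :: "'f::field set \<Rightarrow> 'f poly fract set" where
  "ratfuns F = {Fract p q | p q.
     (\<forall>i. poly.coeff p i \<in> F) \<and> (\<forall>i. poly.coeff q i \<in> F) \<and> q \<noteq> 0}"


section \<open>Value transcendental and residue transcendental extensions\<close>

subsection \<open>The dimension of \<open>A \<otimes> \<rat>\<close>\<close>

definition qscale :: "rat \<Rightarrow> ('b \<Rightarrow>\<^sub>0 rat) \<Rightarrow> ('b \<Rightarrow>\<^sub>0 rat)" where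
  "qscale c f = Poly_Mapping.map ((*) c) f"

lemma lookup_qscale [simp]: "Poly_Mapping.lookup (qscale c f) x = c * Poly_Mapping.lookup f x"
  by (simp add: qscale_def Poly_Mapping.map.rep_eq when_def)

lemma vector_space_qscale: "vector_space qscale"
  by unfold_locales
    (auto intro!: poly_mapping_eqI simp: Poly_Mapping.lookup_add algebra_simps)

text \<open>For an abelian group \<open>A\<close>, the rational vector space \<open>A \<otimes> \<rat>\<close> is \<open>V / W\<close>, where \<open>V\<close> has the basis
  \<open>A\<close> and \<open>W\<close> is the subspace spanned by all \<open>[a \<cdot> b] - [a] - [b]\<close>; the class of \<open>q [a]\<close> is \<open>a \<otimes> q\<close>.\<close>

definition tensorQ_free :: "('b, 'm) monoid_scheme \<Rightarrow> ('b \<Rightarrow>\<^sub>0 rat) set" where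
  "tensorQ_free A = {f. Poly_Mapping.keys f \<subseteq> carrier A}"

definition tensorQ_relations :: "('b, 'm) monoid_scheme \<Rightarrow> ('b \<Rightarrow>\<^sub>0 rat) set" where
  "tensorQ_relations A = module.span qscale
     {Poly_Mapping.single (a \<otimes>\<^bsub>A\<^esub> b) 1 - Poly_Mapping.single a 1 - Poly_Mapping.single b 1 | a b.
        a \<in> carrier A \<and> b \<in> carrier A}"

text \<open>\<open>dim (A \<otimes> \<rat>) = n\<close>: the classes modulo \<open>W\<close> of some \<open>n\<close> elements of \<open>V\<close> form a basis of \<open>V / W\<close>.\<close>

definition tensorQ_dim_eq :: "('b, 'm) monoid_scheme \<Rightarrow> nat \<Rightarrow> bool" where
  "tensorQ_dim_eq A n \<longleftrightarrow>
     (\<exists>B. B \<subseteq> tensorQ_free A \<and> finite B \<and> card B = n \<and>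
        (\<forall>c. (\<Sum>b\<in>B. qscale (c b) b) \<in> tensorQ_relations A \<longrightarrow> (\<forall>b\<in>B. c b = 0)) \<and>
        (\<forall>x\<in>tensorQ_free A. \<exists>c. x - (\<Sum>b\<in>B. qscale (c b) b) \<in> tensorQ_relations A))"

definition group_on :: "'g::ab_group_add set \<Rightarrow> 'g monoid" where
  "group_on G = \<lparr>carrier = G, monoid.mult = (+), one = 0\<rparr>"

text \<open>From here on \<open>F\<close> is a subfield of \<^typ>\<open>'f\<close> and \<open>v\<close> a valuation on a field containing \<open>F(X)\<close>.\<close>

definition value_transcendental ::
  "'f::field set \<Rightarrow> ('f poly fract \<Rightarrow> 'g::linordered_ab_group_add extended) \<Rightarrow> bool" where
  "value_transcendental F v \<longleftrightarrow>
     tensorQ_dim_eq (group_on (value_group (ratfuns F) v) Mod value_group (cst ` F) v) 1"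

subsection \<open>Residue fields and transcendence degree\<close>

definition valuation_ring ::
  "'f::field set \<Rightarrow> ('f \<Rightarrow> 'g::linordered_ab_group_add extended) \<Rightarrow> 'f ring" where
  "valuation_ring F v = ring_on {x\<in>F. 0 \<le> v x}"

definition valuation_ideal ::
  "'f::field set \<Rightarrow> ('f \<Rightarrow> 'g::linordered_ab_group_add extended) \<Rightarrow> 'f set" where
  "valuation_ideal F v = {x\<in>F. 0 < v x}"

definition residue_field ::
  "'f::field set \<Rightarrow> ('f \<Rightarrow> 'g::linordered_ab_group_add extended) \<Rightarrow> 'f set ring" where
  "residue_field F v = valuation_ring F v Quot valuation_ideal F v"

text \<open>The residue field of a subfield \<open>E\<close> of \<open>F\<close>, as a subfield of the residue field of \<open>F\<close>.\<close>

definition residue_subfield ::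
  "'f::field set \<Rightarrow> ('f \<Rightarrow> 'g::linordered_ab_group_add extended) \<Rightarrow> 'f set \<Rightarrow> 'f set set" where
  "residue_subfield F v E =
     (\<lambda>x. valuation_ideal F v +>\<^bsub>valuation_ring F v\<^esub> x) ` {x\<in>E. 0 \<le> v x}"

text \<open>\<open>trdeg [L : k] = n\<close>: there is a transcendence basis with \<open>n\<close> elements.\<close>

definition trdeg_eq :: "('b, 'm) ring_scheme \<Rightarrow> 'b set \<Rightarrow> nat \<Rightarrow> bool" where
  "trdeg_eq L k n \<longleftrightarrow>
     (\<exists>S. S \<subseteq> carrier L \<and> finite S \<and> card S = n \<and>
        (\<forall>s\<in>S. ring.transcendental L (generate_field L (k \<union> (S - {s}))) s) \<and>
        (\<forall>x\<in>carrier L. ring.algebraic L (generate_field L (k \<union> S)) x))"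

definition residue_transcendental ::
  "'f::field set \<Rightarrow> ('f poly fract \<Rightarrow> 'g::linordered_ab_group_add extended) \<Rightarrow> bool" where
  "residue_transcendental F v \<longleftrightarrow>
     trdeg_eq (residue_field (ratfuns F) v) (residue_subfield (ratfuns F) v (cst ` F)) 1"

definition valuation_transcendental ::
  "'f::field set \<Rightarrow> ('f poly fract \<Rightarrow> 'g::linordered_ab_group_add extended) \<Rightarrow> bool" where
  "valuation_transcendental F v \<longleftrightarrow> value_transcendental F v \<or> residue_transcendental F v"

definition valuation_algebraic ::
  "'f::field set \<Rightarrow> ('f poly fract \<Rightarrow> 'g::linordered_ab_group_add extended) \<Rightarrow> bool" where
  "valuation_algebraic F v \<longleftrightarrow> \<not> valuation_transcendental F v"


section \<open>Pairs of definition\<close>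

text \<open>\<open>w\<close> is the valuation \<open>v\<^bsub>a,\<gamma>\<^esub>\<close> on \<open>F(X)\<close> formed from the valuation \<open>v\<close> on \<open>F\<close>; the inner sum
  is \<open>i\<gamma>\<close>.\<close>

definition is_v_a_gamma ::
  "'f::field set \<Rightarrow> ('f \<Rightarrow> 'g::linordered_ab_group_add extended) \<Rightarrow> 'f \<Rightarrow> 'g
     \<Rightarrow> ('f poly fract \<Rightarrow> 'g extended) \<Rightarrow> bool" where
  "is_v_a_gamma F v a \<gamma> w \<longleftrightarrow>
     valuation (ring_on (ratfuns F)) w \<and>
     (\<forall>n C. (\<forall>i\<le>n. C i \<in> F) \<longrightarrow>
        w (\<Sum>i\<le>n. cst (C i) * (XX - cst a) ^ i) =
          Min ((\<lambda>i. v (C i) + Fin (\<Sum>j<i. \<gamma>)) ` {..n}))"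

definition pair_of_definition ::
  "'f::field set \<Rightarrow> ('f poly fract \<Rightarrow> 'g::linordered_ab_group_add extended) \<Rightarrow> 'f \<Rightarrow> 'g \<Rightarrow> bool" where
  "pair_of_definition F v a \<gamma> \<longleftrightarrow>
     a \<in> alg_cl F \<and> \<gamma> \<in> value_group (ratfuns (alg_cl F)) v \<and>
     is_v_a_gamma (alg_cl F) (\<lambda>c. v (cst c)) a \<gamma> v"


section \<open>Pseudo-Cauchy sequences\<close>

text \<open>Sequences indexed by a limit ordinal \<open>\<lambda>\<close> are rendered as families over a well-ordered subset
  \<open>I\<close> without last element of a linear order, \<open>\<lambda>\<close> being the order type of \<open>I\<close>.\<close>

definition limit_index :: "'i::linorder set \<Rightarrow> bool" where
  "limit_index I \<longleftrightarrow>
     I \<noteq> {} \<and> (\<forall>S\<subseteq>I. S \<noteq> {} \<longrightarrow> (\<exists>m\<in>S. \<forall>s\<in>S. m \<le> s)) \<and> (\<forall>i\<in>I. \<exists>j\<in>I. i < j)"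

definition next_index :: "'i::linorder set \<Rightarrow> 'i \<Rightarrow> 'i" where
  "next_index I i = (LEAST j. j \<in> I \<and> i < j)"

definition pseudo_Cauchy ::
  "'i::linorder set \<Rightarrow> ('f::field \<Rightarrow> 'g::linordered_ab_group_add extended) \<Rightarrow> ('i \<Rightarrow> 'f) \<Rightarrow> bool" where
  "pseudo_Cauchy I v z \<longleftrightarrow>
     (\<forall>i\<in>I. \<forall>j\<in>I. \<forall>k\<in>I. i < j \<and> j < k \<longrightarrow> v (z i - z j) < v (z j - z k))"

definition pseudo_limit ::
  "'i::linorder set \<Rightarrow> ('f::field \<Rightarrow> 'g::linordered_ab_group_add extended) \<Rightarrow> ('i \<Rightarrow> 'f) \<Rightarrow> 'f \<Rightarrow> bool" where
  "pseudo_limit I v z y \<longleftrightarrow> (\<forall>i\<in>I. v (y - z i) = v (z i - z (next_index I i)))"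

definition Cauchy_sequence ::
  "'i::linorder set \<Rightarrow> 'f::field set \<Rightarrow> ('f \<Rightarrow> 'g::linordered_ab_group_add extended) \<Rightarrow> ('i \<Rightarrow> 'f) \<Rightarrow> bool"
where
  "Cauchy_sequence I F v z \<longleftrightarrow>
     (\<forall>i\<in>I. z i \<in> F) \<and> pseudo_Cauchy I v z \<and>
     (\<forall>\<delta>\<in>value_group F v. \<exists>i\<in>I. Fin \<delta> \<le> v (z i - z (next_index I i)))"


section \<open>Induced valuations\<close>

text \<open>With \<open>\<Gamma> = {v (X - c) | c \<in> alg_cl K}\<close>: \<open>g\<close> is a strictly increasing cofinal sequence in \<open>\<Gamma>\<close>,
  and \<open>z\<close> is a sequence in \<^term>\<open>alg_cl K\<close> with \<open>v (X - z i) = g i\<close>.\<close>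

definition approximates_X ::
  "'i::linorder set \<Rightarrow> 'f::field set \<Rightarrow> ('f poly fract \<Rightarrow> 'g::linordered_ab_group_add extended)
     \<Rightarrow> ('i \<Rightarrow> 'g extended) \<Rightarrow> ('i \<Rightarrow> 'f) \<Rightarrow> bool" where
  "approximates_X I K v g z \<longleftrightarrow>
     limit_index I \<and> strict_mono_on I g \<and>
     (\<forall>c\<in>alg_cl K. \<exists>i\<in>I. v (XX - cst c) \<le> g i) \<and>
     (\<forall>i\<in>I. z i \<in> alg_cl K \<and> v (XX - cst (z i)) = g i)"

text \<open>The ambient field is \<open>alg_cl Khat\<close>. The constructed valuation depends, a priori, on choices (of a
  pair of definition, of sequences and of a limit); we ask that the choices can be made and that
  every choice yields \<open>v\<close> on \<open>Khat(X)\<close> up to equivalence. Index sets in the value group type suffice,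
  since every strictly increasing sequence \<open>g\<close> can be reindexed by its own values.\<close>

definition induced_by_transcendental ::
  "'f::alg_closed_field set \<Rightarrow> 'f set
     \<Rightarrow> ('f poly fract \<Rightarrow> 'g::linordered_ab_group_add extended) \<Rightarrow> bool" where
  "induced_by_transcendental K Khat v \<longleftrightarrow>
     (\<exists>b \<beta>. pair_of_definition K v b \<beta>) \<and>
     (\<forall>b \<beta>. pair_of_definition K v b \<beta> \<longrightarrow>
        (\<exists>w :: 'f poly fract \<Rightarrow> 'g extended.
           is_v_a_gamma (alg_cl Khat) (\<lambda>c. v (cst c)) b \<beta> w \<and>
           equivalent_on (ratfuns Khat) v w))"

definition induced_by_algebraic ::
  "'f::alg_closed_field set \<Rightarrow> 'f set
     \<Rightarrow> ('f poly fract \<Rightarrow> 'g::linordered_ab_group_add extended) \<Rightarrow> bool" where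
  "induced_by_algebraic K Khat v \<longleftrightarrow>
     (\<exists>(I :: 'g set) g z. approximates_X I K v g z) \<and>
     (\<forall>(I :: 'g set) g z. approximates_X I K v g z \<longrightarrow>
        (if \<exists>b\<in>alg_cl Khat. pseudo_limit I (\<lambda>c. v (cst c)) z b
         then \<forall>b\<in>alg_cl Khat. pseudo_limit I (\<lambda>c. v (cst c)) z b \<longrightarrow>
                (\<exists>w :: 'f poly fract \<Rightarrow> (int \<times> 'g) extended.
                   is_v_a_gamma (alg_cl Khat) (\<lambda>c. map_extended (\<lambda>\<alpha>. (0, \<alpha>)) (v (cst c))) b (1, 0) w \<and>
                   equivalent_on (ratfuns Khat) v w)
         else \<exists>w :: 'f poly fract \<Rightarrow> 'g extended.
                valuation (ring_on (ratfuns (alg_cl Khat))) w \<and>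
                (\<forall>c\<in>alg_cl Khat. w (cst c) = v (cst c)) \<and>
                pseudo_limit I w (\<lambda>i. cst (z i)) XX \<and>
                equivalent_on (ratfuns Khat) v w))"

definition induced ::
  "'f::alg_closed_field set \<Rightarrow> 'f set
     \<Rightarrow> ('f poly fract \<Rightarrow> 'g::linordered_ab_group_add extended) \<Rightarrow> bool" where
  "induced K Khat v \<longleftrightarrow>
     (if valuation_transcendental K v then induced_by_transcendental K Khat v
      else induced_by_algebraic K Khat v)"

end

theory Submission
  imports Defs
begin

text \<open>By continuity of roots, \<open>alg_cl K\<close> is dense in \<open>alg_cl Khat\<close>, so both have the same value group and
  \<open>v (X - a) = \<gamma>\<close> exceeds the value of every nonzero constant: \<open>X\<close> is infinitely close to \<open>a\<close>. Thus
  \<open>fst \<circ> \<phi>\<close> measures the order of vanishing at \<open>a\<close>. If \<open>a\<close> is algebraic over \<open>K\<close>, then \<open>fst \<circ> \<phi>\<close> is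
  nonzero on \<open>vK(X)\<close> with a kernel that is torsion modulo \<open>vK\<close>, and \<open>(a, \<gamma>)\<close> is the only pair of
  definition over \<open>K\<close>. Otherwise \<open>f(X)\<close> has the value and the residue of \<open>f(a)\<close> for all \<open>f \<in> K(X)\<close>, so
  \<open>vK(X)/vK\<close> is torsion and \<open>K(X)v\<close> is algebraic over \<open>Kv\<close>, while \<open>v (X - c) = v (a - c)\<close> for
  \<open>c \<in> alg_cl K\<close> turns every approximation of \<open>X\<close> into a Cauchy sequence with the unique limit \<open>a\<close>.\<close>

section \<open>Valued fields\<close>

text \<open>The identification compares \<open>\<gamma>\<close> with values of
  \<open>alg_cl K\<close> only, while \<open>a\<close> and the constants range over
  \<open>alg_cl Khat\<close>; density carries the comparison over, and in case (ii) it also supplies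
  approximants of \<open>a\<close> of arbitrarily large value. In case (i) \<open>X - a\<close> need
  not lie in \<open>K(X)\<close>. What does lie there are polynomials over \<open>K\<close>
  vanishing at \<open>a\<close>, and for \<open>a\<close> inseparable over \<open>K\<close> their
  order of vanishing is always a multiple of the characteristic. Hence the dimension criterion takes
  a merely nonzero homomorphism to the integers and divides by its value, which tensoring with the
  rationals permits. In case (ii) \<open>a\<close> is a root of no nonzero polynomial over
  \<open>K\<close>, so \<open>f(a)\<close> is defined for every \<open>f\<close> in
  \<open>K(X)\<close>. The construction then demands a valuation with values in
  \<open>int \<times> 'g\<close>, although \<open>v\<close> takes values in \<open>'g\<close>; it is
  obtained by composing \<open>v\<close> with \<open>\<phi>\<close>.\<close>

lemma ring_on_simps [simp]:
  "carrier (ring_on S) = S"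
  "x \<otimes>\<^bsub>ring_on S\<^esub> y = x * y"
  "x \<oplus>\<^bsub>ring_on S\<^esub> y = x + y"
  "\<zero>\<^bsub>ring_on S\<^esub> = 0"
  "\<one>\<^bsub>ring_on S\<^esub> = 1"
  by (simp_all add: ring_on_def ring_of_type_algebra_def)

locale valued_field =
  fixes v :: "'f::field \<Rightarrow> 'g::linordered_ab_group_add extended"
  assumes valuation: "valuation (ring_on UNIV) v"
begin

lemma v_neq_Minf [simp]: "v x \<noteq> Minf" "Minf \<noteq> v x"
  and v_eq_Pinf_iff [simp]: "v x = Pinf \<longleftrightarrow> x = 0" "Pinf = v x \<longleftrightarrow> x = 0"
  and v_mult: "v (x * y) = v x + v y"
  and v_add: "min (v x) (v y) \<le> v (x + y)"
  using valuation unfolding valuation_def by (simp_all add: eq_commute[of Minf] eq_commute[of Pinf])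

lemma v_0 [simp]: "v 0 = Pinf"
  by simp

lemma v_finite:
  assumes "x \<noteq> 0"
  obtains \<delta> where "v x = Fin \<delta>"
  using assms by (cases "v x") auto

lemma v_1 [simp]: "v 1 = 0"
proof -
  obtain \<delta> where \<delta>: "v 1 = Fin \<delta>"
    using v_finite[of 1] by auto
  have "v 1 + v 1 = v 1"
    using v_mult[of 1 1] by simp
  then show ?thesis
    by (simp add: \<delta> zero_extended_def)
qed

lemma v_minus [simp]: "v (- x) = v x"
proof -
  obtain \<delta> where \<delta>: "v (-1) = Fin \<delta>"
    using v_finite[of "-1"] by auto
  have "v (-1) + v (-1) = v 1"
    using v_mult[of "-1" "-1"] by simp
  then have "\<delta> = 0"
    by (simp add: \<delta> zero_extended_def)
  then show ?thesis
    using v_mult[of "-1" x] \<delta> by (simp flip: zero_extended_def)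
qed

lemma v_diff_commute: "v (x - y) = v (y - x)"
  using v_minus[of "x - y"] by simp

lemma v_diff: "min (v x) (v y) \<le> v (x - y)"
  using v_add[of x "- y"] by simp

lemma v_add_eq:
  assumes "v x < v y"
  shows "v (x + y) = v x"
  using v_add[of x y] v_diff[of "x + y" y] assms by (auto simp: min_def split: if_splits)

lemma v_add_less: "\<delta> < v x \<Longrightarrow> \<delta> < v y \<Longrightarrow> \<delta> < v (x + y)"
  using v_add[of x y] by (auto simp: min_def split: if_splits)

lemma v_diff_less: "\<delta> < v x \<Longrightarrow> \<delta> < v y \<Longrightarrow> \<delta> < v (x - y)"
  using v_diff[of x y] by (auto simp: min_def split: if_splits)

lemma v_eqI:
  assumes "v x < v (x - y)"
  shows "v y = v x"
  using v_add_eq[of x "y - x"] assms by (simp add: v_diff_commute)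

lemma v_sum_greater:
  assumes "finite A" "\<And>i. i \<in> A \<Longrightarrow> Fin \<delta> < v (f i)"
  shows "Fin \<delta> < v (sum f A)"
  using assms by (induction A rule: finite_induct) (auto intro: v_add_less)

lemma v_inverse:
  assumes "v x = Fin \<delta>"
  shows "v (inverse x) = Fin (- \<delta>)"
proof -
  have "x \<noteq> 0"
    using assms by auto
  then obtain \<epsilon> where \<epsilon>: "v (inverse x) = Fin \<epsilon>"
    using v_finite[of "inverse x"] by auto
  have "v x + v (inverse x) = 0"
    using v_mult[of x "inverse x"] \<open>x \<noteq> 0\<close> by simp
  then show ?thesis
    using assms \<epsilon> by (simp add: zero_extended_def eq_neg_iff_add_eq_0 add.commute)
qed

lemma v_divide:
  assumes "v x = Fin \<delta>" "v y = Fin \<epsilon>"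
  shows "v (x / y) = Fin (\<delta> - \<epsilon>)"
  using assms v_mult[of x "inverse y"] v_inverse by (simp add: divide_inverse)

lemma v_mult_less:
  assumes "v x < v y" "z \<noteq> 0"
  shows "v (x * z) < v (y * z)"
proof -
  obtain \<delta> where "v z = Fin \<delta>"
    using v_finite[OF assms(2)] .
  then show ?thesis
    using assms(1) by (cases "v x"; cases "v y") (auto simp: v_mult)
qed

lemma v_power_mono:
  assumes "v x \<le> v y"
  shows "v (x ^ n) \<le> v (y ^ n)"
  by (induction n) (auto simp: v_mult assms intro: add_mono)

lemma v_nonneg_add: "0 \<le> v x \<Longrightarrow> 0 \<le> v y \<Longrightarrow> 0 \<le> v (x + y)"
  using v_add[of x y] by (meson min.boundedI order_trans)

lemma v_nonneg_mult: "0 \<le> v x \<Longrightarrow> 0 \<le> v y \<Longrightarrow> 0 \<le> v (x * y)"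
  using add_mono[of 0 "v x" 0 "v y"] by (simp add: v_mult)

lemma v_nonneg_mult_pos: "0 \<le> v x \<Longrightarrow> 0 < v y \<Longrightarrow> 0 < v (x * y)"
  by (cases "v x"; cases "v y") (auto simp: v_mult zero_extended_def add_nonneg_pos)

lemma v_nonneg_power: "0 \<le> v x \<Longrightarrow> 0 \<le> v (x ^ n)"
  by (induction n) (auto intro: v_nonneg_mult)

text \<open>Two nonzero terms of minimal value must cancel.\<close>

lemma sum_eq_0_imp_two_terms:
  assumes "finite A" "sum f A = 0" "\<exists>i\<in>A. f i \<noteq> 0"
  obtains i j where "i \<in> A" "j \<in> A" "i \<noteq> j" "v (f i) = v (f j)" "f i \<noteq> 0" "f j \<noteq> 0"
proof -
  obtain i where i: "i \<in> A" "\<And>k. k \<in> A \<Longrightarrow> v (f i) \<le> v (f k)"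
    using arg_min_if_finite[of A "\<lambda>k. v (f k)"] assms
    by (metis empty_iff not_le arg_min_if_finite)
  have "f i \<noteq> 0"
    using i assms by (metis Pinf_le v_eq_Pinf_iff(1))
  then obtain \<delta> where \<delta>: "v (f i) = Fin \<delta>"
    using v_finite by blast
  have "\<exists>j\<in>A - {i}. v (f j) \<le> v (f i)"
  proof (rule ccontr)
    assume "\<not> ?thesis"
    then have "Fin \<delta> < v (sum f (A - {i}))"
      using assms \<delta> by (intro v_sum_greater) (auto simp: not_le)
    moreover have "sum f (A - {i}) = - f i"
      using assms i by (simp add: sum_diff1)
    ultimately show False
      using \<delta> by simp
  qed
  then obtain j where "j \<in> A" "j \<noteq> i" "v (f j) = v (f i)"
    using i by (auto intro: antisym)
  then show thesis
    using that[of i j] i \<open>f i \<noteq> 0\<close> \<delta> by (metis v_eq_Pinf_iff(1))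
qed

end

section \<open>Subfields and relative algebraic closures, in terms of the operations of the
  type\<close>

lemma is_subfieldD:
  assumes "is_subfield F"
  shows "0 \<in> F" "1 \<in> F" "\<And>x y. x \<in> F \<Longrightarrow> y \<in> F \<Longrightarrow> x + y \<in> F"
    "\<And>x y. x \<in> F \<Longrightarrow> y \<in> F \<Longrightarrow> x * y \<in> F" "\<And>x. x \<in> F \<Longrightarrow> - x \<in> F"
    "\<And>x. x \<in> F \<Longrightarrow> inverse x \<in> F"
proof -
  let ?R = "ring_of_type_algebra :: 'a ring"
  interpret R: field ?R
    by (rule field_from_type_algebra)
  have sub: "subfield F ?R"
    using assms by (simp add: is_subfield_def)
  note sub' = subfieldE(1)[OF sub]
  have R: "x \<oplus>\<^bsub>?R\<^esub> y = x + y" "x \<otimes>\<^bsub>?R\<^esub> y = x * y" "\<zero>\<^bsub>?R\<^esub> = 0" "\<one>\<^bsub>?R\<^esub> = 1"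
    "carrier ?R = UNIV" for x y
    by (simp_all add: ring_of_type_algebra_def)
  have minus: "\<ominus>\<^bsub>?R\<^esub> x = - x" for x
    by (rule R.minus_equality) (simp_all add: R)
  have inv: "inv\<^bsub>?R\<^esub> x = inverse x" if "x \<noteq> 0" for x
    using that by (intro R.comm_inv_char) (simp_all add: R)
  show "0 \<in> F" "1 \<in> F"
    using subringE(2,3)[OF sub'] by (simp_all add: R)
  show "x + y \<in> F" "x * y \<in> F" if "x \<in> F" "y \<in> F" for x y
    using subringE(6,7)[OF sub' that] by (simp_all add: R)
  show "- x \<in> F" if "x \<in> F" for x
    using subringE(5)[OF sub' that] by (simp add: minus)
  show "inverse x \<in> F" if "x \<in> F" for x
    using R.subfield_m_inv(1)[OF sub, of x] that inv[of x] \<open>0 \<in> F\<close>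
    by (cases "x = 0") (auto simp: R)
qed

lemma is_subfield_sum:
  assumes "is_subfield F" "\<And>i. i \<in> A \<Longrightarrow> f i \<in> F"
  shows "sum f A \<in> F"
  using assms(2) by (induction A rule: infinite_finite_induct) (auto simp: is_subfieldD[OF assms(1)])

lemma is_subfield_divide: "is_subfield F \<Longrightarrow> x \<in> F \<Longrightarrow> y \<in> F \<Longrightarrow> x / y \<in> F"
  by (simp add: divide_inverse is_subfieldD)

lemma cring_ring_on:
  assumes "1 \<in> S" "\<And>x y. x \<in> S \<Longrightarrow> y \<in> S \<Longrightarrow> x + y \<in> S"
    "\<And>x y. x \<in> S \<Longrightarrow> y \<in> S \<Longrightarrow> x * y \<in> S" "\<And>x. x \<in> S \<Longrightarrow> - x \<in> S"
  shows "cring (ring_on S)"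
proof -
  have "0 \<in> S"
    using assms(1) assms(2)[of 1 "-1"] assms(4)[of 1] by simp
  then show ?thesis
    using assms by (intro cringI abelian_groupI comm_monoidI) (auto simp: algebra_simps intro: bexI[of _ "- _"])
qed

lemma is_subfieldI:
  fixes F :: "'f::field set"
  assumes "1 \<in> F" "\<And>x y. x \<in> F \<Longrightarrow> y \<in> F \<Longrightarrow> x + y \<in> F"
    "\<And>x y. x \<in> F \<Longrightarrow> y \<in> F \<Longrightarrow> x * y \<in> F" "\<And>x. x \<in> F \<Longrightarrow> - x \<in> F"
    "\<And>x. x \<in> F \<Longrightarrow> x \<noteq> 0 \<Longrightarrow> inverse x \<in> F"
  shows "is_subfield F"
proof -
  let ?R = "ring_of_type_algebra :: 'f ring"
  interpret R: field ?R
    by (rule field_from_type_algebra)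
  interpret F: cring "ring_on F"
    by (rule cring_ring_on) (use assms in auto)
  have "subring F ?R"
    using F.ring_axioms unfolding ring_on_def by (intro R.ring_incl_imp_subring) (auto simp: ring_of_type_algebra_def)
  moreover have "inv\<^bsub>?R\<^esub> x = inverse x" if "x \<noteq> 0" for x
    using that by (intro R.comm_inv_char) (simp_all add: ring_of_type_algebra_def)
  ultimately have "subfield F ?R"
    using assms(5) by (intro R.subfieldI') (auto simp: ring_of_type_algebra_def)
  then show ?thesis
    by (simp add: is_subfield_def)
qed

text \<open>Subtraction in \<open>ring_on S\<close> uses the additive inverse within
  \<open>S\<close>, so agreement with the subtraction of the type is guaranteed only when
  \<open>- y\<close> lies in \<open>S\<close>. It unfolds the difference in
  \<open>dense_in\<close>.\<close>

lemma minus_ring_on [simp]: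
  assumes "cring (ring_on S)" "x \<in> S" "y \<in> S" "- y \<in> S"
  shows "x \<ominus>\<^bsub>ring_on S\<^esub> y = x - y"
proof -
  interpret R: cring "ring_on S"
    by fact
  have "\<ominus>\<^bsub>ring_on S\<^esub> y = - y"
    using assms by (intro R.minus_equality) auto
  then show ?thesis
    by (simp add: a_minus_def)
qed

lemma is_subfield_cring: "is_subfield F \<Longrightarrow> cring (ring_on F)"
  by (rule cring_ring_on) (auto simp: is_subfieldD)

lemma subset_alg_cl:
  assumes "is_subfield F"
  shows "F \<subseteq> alg_cl F"
proof
  fix c assume "c \<in> F"
  then have "\<forall>i. poly.coeff [:- c, 1:] i \<in> F"
    using is_subfieldD[OF assms] by (auto simp: coeff_pCons split: nat.splits)
  moreover have "[:- c, 1:] \<noteq> 0" "poly [:- c, 1:] c = 0"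
    by auto
  ultimately show "c \<in> alg_cl F"
    unfolding alg_cl_def by blast
qed

lemma alg_clE_monic:
  assumes "is_subfield F" "x \<in> alg_cl F"
  obtains p where "\<And>i. poly.coeff p i \<in> F" "poly p x = 0" "Polynomial.lead_coeff p = 1"
proof -
  obtain p where p: "p \<noteq> 0" "\<forall>i. poly.coeff p i \<in> F" "poly p x = 0"
    using assms by (auto simp: alg_cl_def)
  show thesis
    by (rule that[of "smult (inverse (poly.coeff p (Polynomial.degree p))) p"])
      (use p in \<open>auto simp: is_subfieldD[OF assms(1)]\<close>)
qed

section \<open>Values of algebraic elements\<close>

context valued_field
begin

text \<open>\<open>poly p c\<close> is the product of the factors \<open>c - r\<close> over the
  roots \<open>r\<close>, each of value at most \<open>v d\<close>. Used in contrapositive form: a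
  value at \<open>c\<close> above that of \<open>d ^ degree\<close> forces a root closer to
  \<open>c\<close> than \<open>v d\<close>. Bounding by an element \<open>d\<close> rather than by a
  value turns multiples of values into powers.\<close>

lemma v_monic_le:
  fixes p :: "'f poly"
  assumes "\<And>q :: 'f poly. Polynomial.degree q > 0 \<Longrightarrow> \<exists>x. poly q x = 0"
    and "Polynomial.lead_coeff p = 1" "\<And>r. poly p r = 0 \<Longrightarrow> v (c - r) \<le> v d"
  shows "v (poly p c) \<le> v (d ^ Polynomial.degree p)"
  using assms(2,3)
proof (induction "Polynomial.degree p" arbitrary: p)
  case 0
  then obtain a where "p = [:a:]"
    using degree_eq_zeroE by metis
  then have "p = 1"
    using 0 by simp
  then show ?case
    by simp
next
  case (Suc n)
  then obtain r where r: "poly p r = 0"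
    using assms(1)[of p] by auto
  then obtain q where q: "p = [:- r, 1:] * q"
    by (auto simp: poly_eq_0_iff_dvd)
  have "q \<noteq> 0"
    using Suc.hyps(2) q by auto
  then have deg: "Polynomial.degree p = Suc (Polynomial.degree q)"
    unfolding q by (subst degree_mult_eq) auto
  have "Polynomial.lead_coeff q = 1"
    using Suc.prems(1) unfolding q lead_coeff_mult by simp
  moreover have "v (c - r') \<le> v d" if "poly q r' = 0" for r'
    using Suc.prems(2)[of r'] that by (simp add: q)
  ultimately have "v (poly q c) \<le> v (d ^ n)"
    using Suc.hyps deg by simp
  then have "v (c - r) + v (poly q c) \<le> v d + v (d ^ n)"
    using Suc.prems(2)[OF r] by (intro add_mono) auto
  then show ?case
    using deg Suc.hyps(2) by (simp add: q v_mult left_diff_distrib[symmetric])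
qed

text \<open>In the equation \<open>p(x) = 0\<close> two nonzero terms have equal value, say those of
  degrees \<open>i < j\<close>; cancelling \<open>x ^ i\<close> gives \<open>x ^ (j - i)\<close> the
  value of a quotient of coefficients.\<close>

lemma alg_cl_torsion:
  assumes "is_subfield F" "x \<in> alg_cl F" "x \<noteq> 0"
  obtains n d where "n > 0" "d \<in> F" "d \<noteq> 0" "v (x ^ n) = v d"
proof -
  obtain p where p: "p \<noteq> 0" "\<forall>i. poly.coeff p i \<in> F" "poly p x = 0"
    using assms by (auto simp: alg_cl_def)
  let ?f = "\<lambda>i. poly.coeff p i * x ^ i"
  have "?f (Polynomial.degree p) \<noteq> 0"
    using p assms(3) by simp
  then have "\<exists>i\<in>{..Polynomial.degree p}. ?f i \<noteq> 0"
    by blast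
  then obtain i j where ij: "i \<noteq> j" "v (?f i) = v (?f j)" "?f i \<noteq> 0" "?f j \<noteq> 0"
    using p(3) sum_eq_0_imp_two_terms[of "{..Polynomial.degree p}" ?f thesis] by (auto simp: poly_altdef)
  note goal = that
  have *: thesis if "i < j" "v (?f i) = v (?f j)" "?f i \<noteq> 0" "?f j \<noteq> 0" for i j
  proof (rule goal[of "j - i" "poly.coeff p i / poly.coeff p j"])
    have "poly.coeff p i \<noteq> 0" "poly.coeff p j \<noteq> 0"
      using that by auto
    then obtain \<alpha> \<beta> \<xi> \<eta> where \<alpha>: "v (poly.coeff p i) = Fin \<alpha>" "v (poly.coeff p j) = Fin \<beta>"
      "v (x ^ i) = Fin \<xi>" "v (x ^ (j - i)) = Fin \<eta>"
      using v_finite assms(3) power_not_zero by metis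
    have "x ^ j = x ^ i * x ^ (j - i)"
      using that by (simp flip: power_add)
    then have "\<alpha> + \<xi> = \<beta> + (\<xi> + \<eta>)"
      using that \<alpha> by (simp add: v_mult)
    then have "\<eta> = \<alpha> - \<beta>"
      by (simp add: algebra_simps)
    then show "v (x ^ (j - i)) = v (poly.coeff p i / poly.coeff p j)"
      using \<alpha> by (simp add: v_divide)
  qed (use that p is_subfield_divide[OF assms(1)] in auto)
  show thesis
    using *[of i j] *[of j i] ij by (metis nat_neq_iff)
qed

text \<open>If \<open>v x > 0\<close>, then \<open>v x\<close> is at most its \<open>n\<close>-fold
  multiple, which is a value of \<open>F\<close>; otherwise 1 is a bound. Density of
  \<open>K\<close> in \<open>F\<close> provides precision only up to values of \<open>F\<close>, and
  this makes it reach values of algebraic elements.\<close>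

lemma alg_cl_v_bounded:
  assumes "is_subfield F" "x \<in> alg_cl F" "x \<noteq> 0"
  obtains d where "d \<in> F" "d \<noteq> 0" "v x \<le> v d"
proof -
  obtain n d where d: "n > 0" "d \<in> F" "d \<noteq> 0" "v (x ^ n) = v d"
    using alg_cl_torsion[OF assms] .
  show thesis
  proof (cases "v x \<le> 0")
    case True
    then show thesis
      using that[of 1] is_subfieldD[OF assms(1)] by simp
  next
    case False
    have "v 1 \<le> v (x ^ (n - 1))"
      using v_power_mono[of 1 x "n - 1"] False by simp
    then have "v x + v 1 \<le> v x + v (x ^ (n - 1))"
      by (intro add_left_mono) auto
    also have "\<dots> = v d"
      using d by (simp flip: v_mult power_Suc)
    finally show thesis
      using that[of d] d by simp
  qed
qed

end

text \<open>Continuity of roots: a monic polynomial over \<open>K\<close> close to one over \<open>F\<close> that vanishes at \<open>x\<close> takes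
  a value at \<open>x\<close> so small that one of its roots is close to \<open>x\<close>.\<close>

lemma (in valued_field) alg_cl_dense:
  assumes roots: "\<And>q :: 'f poly. Polynomial.degree q > 0 \<Longrightarrow> \<exists>x. poly q x = 0"
    and K: "is_subfield K" "is_subfield F" "K \<subseteq> F"
    and dense: "dense_in (ring_on F) K v"
    and F: "alg_cl F = UNIV"
    and "d \<noteq> 0"
  obtains b where "b \<in> alg_cl K" "v d < v (x - b)"
proof -
  obtain p where p: "\<And>i. poly.coeff p i \<in> F" "poly p x = 0" "Polynomial.lead_coeff p = 1"
    using alg_clE_monic[OF K(2), of x] F by blast
  define n where "n = Polynomial.degree p"
  \<comment> \<open>The precision is \<open>d ^ n\<close> because \<open>n\<close> roots, none
    closer to \<open>x\<close> than \<open>v d\<close>, would bound the value of the polynomial at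
    \<open>x\<close> by \<open>v (d ^ n)\<close>.\<close>
  have "d ^ n \<noteq> 0"
    using \<open>d \<noteq> 0\<close> by simp
  then obtain \<delta> where \<delta>: "v (d ^ n) = Fin \<delta>"
    using v_finite by metis
  have close: "\<exists>b\<in>K. v (d ^ n) < v ((b - c) * x ^ i)" if "c \<in> F" for c i
  proof (cases "x ^ i = 0")
    case True
    then have "v ((0 - c) * x ^ i) = Pinf"
      by (simp only: mult_zero_right v_0)
    then show ?thesis
      using \<delta> is_subfieldD(1)[OF K(1)] by (metis less_extended_simps(2))
  next
    case False
    then have "d ^ n / x ^ i \<noteq> 0"
      using \<open>d \<noteq> 0\<close> by simp
    \<comment> \<open>The required precision need not be a value of \<open>F\<close>, so it is first
      raised to one.\<close>
    then obtain e where e: "e \<in> F" "e \<noteq> 0" "v (d ^ n / x ^ i) \<le> v e"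
      by (rule alg_cl_v_bounded[OF K(2), of "d ^ n / x ^ i", unfolded F, OF UNIV_I])
    obtain \<epsilon> where \<epsilon>: "v e = Fin \<epsilon>"
      using v_finite[OF e(2)] .
    then obtain b where b: "b \<in> K" "v e < v (c - b)"
    proof -
      have "\<epsilon> \<in> value_group F v"
        using e \<epsilon> by (auto simp: value_group_def)
      then obtain b where b: "b \<in> K" "Fin \<epsilon> < v (c \<ominus>\<^bsub>ring_on F\<^esub> b)"
        using dense \<open>c \<in> F\<close> by (auto simp: dense_in_def)
      moreover have "c \<ominus>\<^bsub>ring_on F\<^esub> b = c - b"
        using b K \<open>c \<in> F\<close> is_subfieldD(5)[OF K(2)] is_subfield_cring[OF K(2)]
        by (intro minus_ring_on) auto
      ultimately show thesis
        using that \<epsilon> by simp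
    qed
    have "v (d ^ n / x ^ i) < v (b - c)"
      using e b by (simp add: v_diff_commute[of b])
    then have "v (d ^ n / x ^ i * x ^ i) < v ((b - c) * x ^ i)"
      using False by (rule v_mult_less)
    then show ?thesis
      using b False by auto
  qed
  have "\<forall>i. \<exists>b. b \<in> K \<and> v (d ^ n) < v ((b - poly.coeff p i) * x ^ i)"
    using close[OF p(1)] by blast
  from choice[OF this] obtain B where
    B: "\<And>i. B i \<in> K" "\<And>i. v (d ^ n) < v ((B i - poly.coeff p i) * x ^ i)"
    by blast
  \<comment> \<open>The leading coefficient stays exactly 1, so \<open>q\<close> is monic of the
    same degree and the top terms of \<open>q\<close> and \<open>p\<close> cancel.\<close>
  define q where "q = Polynomial.monom 1 n + (\<Sum>i<n. Polynomial.monom (B i) i)"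
  have coeff_q: "poly.coeff q i = (if i < n then B i else if i = n then 1 else 0)" for i
    unfolding q_def by (auto simp: coeff_sum)
  have deg: "Polynomial.degree q = n"
  proof (rule antisym)
    show "Polynomial.degree q \<le> n"
      by (rule Polynomial.degree_le) (simp add: coeff_q)
    show "n \<le> Polynomial.degree q"
      by (rule Polynomial.le_degree) (simp add: coeff_q)
  qed
  have q_K: "poly.coeff q i \<in> K" for i
    using B is_subfieldD[OF K(1)] by (auto simp: coeff_q)
  have "poly q x = poly q x - poly p x"
    using p by simp
  also have "\<dots> = (\<Sum>i\<le>n. (poly.coeff q i - poly.coeff p i) * x ^ i)"
    using deg by (simp add: poly_altdef n_def sum_subtractf left_diff_distrib)
  also have "\<dots> = (\<Sum>i<n. (B i - poly.coeff p i) * x ^ i)"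
    using p(3) by (simp add: lessThan_Suc_atMost[symmetric] coeff_q n_def)
  finally have "v (d ^ n) < v (poly q x)"
    using v_sum_greater[of "{..<n}" \<delta> "\<lambda>i. (B i - poly.coeff p i) * x ^ i"] B(2) \<delta> by simp
  then have less: "v (d ^ Polynomial.degree q) < v (poly q x)"
    by (simp only: deg)
  have q: "Polynomial.lead_coeff q = 1"
    using deg coeff_q by simp
  have "\<exists>r. poly q r = 0 \<and> v d < v (x - r)"
  proof (rule ccontr)
    assume "\<not> ?thesis"
    then have "v (x - r) \<le> v d" if "poly q r = 0" for r
      using that by (meson not_le)
    from v_monic_le[OF roots q this] show False
      using less by simp
  qed
  then obtain r where r: "poly q r = 0" "v d < v (x - r)"
    by blast
  have "r \<in> alg_cl K"
  proof -
    have "q \<noteq> 0"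
      using q by auto
    then show ?thesis
      unfolding alg_cl_def using q_K r(1) by blast
  qed
  then show thesis
    using that r by blast
qed

section \<open>The dimension of \<open>A \<otimes> \<rat>\<close>\<close>

interpretation qscale: vector_space qscale
  by (rule vector_space_qscale)

abbreviation tensorQ_gen :: "'b \<Rightarrow> 'b \<Rightarrow>\<^sub>0 rat" where
  "tensorQ_gen a \<equiv> Poly_Mapping.single a 1"

lemma subspace_tensorQ_relations: "qscale.subspace (tensorQ_relations A)"
  unfolding tensorQ_relations_def by (rule qscale.subspace_span)

lemmas tensorQ_relations_add = qscale.subspace_add[OF subspace_tensorQ_relations]
  and tensorQ_relations_diff = qscale.subspace_diff[OF subspace_tensorQ_relations]
  and tensorQ_relations_scale = qscale.subspace_scale[OF subspace_tensorQ_relations]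
  and tensorQ_relations_sum = qscale.subspace_sum[OF subspace_tensorQ_relations]

lemma poly_mapping_eq_sum_qscale: "f = (\<Sum>x\<in>Poly_Mapping.keys f. qscale (Poly_Mapping.lookup f x) (tensorQ_gen x))"
proof (rule poly_mapping_eqI)
  fix x
  show "Poly_Mapping.lookup f x = Poly_Mapping.lookup (\<Sum>x\<in>Poly_Mapping.keys f. qscale (Poly_Mapping.lookup f x) (tensorQ_gen x)) x"
    by (simp add: lookup_sum lookup_single when_def if_distrib sum.delta in_keys_iff cong: if_cong)
qed

text \<open>By linearity it suffices that every generator is congruent to a multiple of
  \<open>b\<close>. The case \<open>b = 0\<close> shows that the tensor product vanishes, the case
  of a generator \<open>b\<close> that \<open>b\<close> spans it.\<close>

lemma tensorQ_free_sum_relations: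
  assumes "\<And>g. g \<in> carrier A \<Longrightarrow> tensorQ_gen g - qscale (c g) b \<in> tensorQ_relations A"
    and "f \<in> tensorQ_free A"
  shows "\<exists>d. f - qscale d b \<in> tensorQ_relations A"
proof -
  let ?l = "Poly_Mapping.lookup f"
  have "qscale (?l x) (tensorQ_gen x) - qscale (?l x * c x) b \<in> tensorQ_relations A"
    if "x \<in> Poly_Mapping.keys f" for x
  proof -
    have "qscale (?l x) (tensorQ_gen x - qscale (c x) b) \<in> tensorQ_relations A"
      using assms that by (intro tensorQ_relations_scale) (auto simp: tensorQ_free_def)
    then show ?thesis
      by (simp add: qscale.scale_right_diff_distrib qscale.scale_scale)
  qed
  then have "(\<Sum>x\<in>Poly_Mapping.keys f. qscale (?l x) (tensorQ_gen x) - qscale (?l x * c x) b) \<in> tensorQ_relations A"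
    by (rule tensorQ_relations_sum)
  also have "(\<Sum>x\<in>Poly_Mapping.keys f. qscale (?l x) (tensorQ_gen x) - qscale (?l x * c x) b)
      = f - qscale (\<Sum>x\<in>Poly_Mapping.keys f. ?l x * c x) b"
    using poly_mapping_eq_sum_qscale[of f] by (simp add: sum_subtractf qscale.scale_sum_left)
  finally show ?thesis
    by blast
qed

lemma (in group) tensorQ_gen_mult:
  assumes "a \<in> carrier G" "b \<in> carrier G"
  shows "tensorQ_gen (a \<otimes> b) - tensorQ_gen a - tensorQ_gen b \<in> tensorQ_relations G"
  using assms unfolding tensorQ_relations_def by (intro qscale.span_base) blast

lemma (in group) tensorQ_gen_one: "tensorQ_gen \<one> \<in> tensorQ_relations G"
proof -
  have "- tensorQ_gen \<one> \<in> tensorQ_relations G"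
    using tensorQ_gen_mult[of \<one> \<one>] by simp
  then show ?thesis
    using tensorQ_relations_scale[of _ _ "-1"] by (fastforce simp: qscale.scale_minus_left)
qed

lemma (in group) tensorQ_gen_nat_pow:
  assumes "a \<in> carrier G"
  shows "tensorQ_gen (a [^] n) - qscale (of_nat n) (tensorQ_gen a) \<in> tensorQ_relations G"
proof (induction n)
  case 0
  then show ?case
    using tensorQ_gen_one by simp
next
  case (Suc n)
  have "(tensorQ_gen (a [^] n \<otimes> a) - tensorQ_gen (a [^] n) - tensorQ_gen a)
      + (tensorQ_gen (a [^] n) - qscale (of_nat n) (tensorQ_gen a)) \<in> tensorQ_relations G"
    using Suc tensorQ_gen_mult[of "a [^] n" a] assms
    by (intro tensorQ_relations_add) auto
  then show ?case
    by (simp add: qscale.scale_left_distrib algebra_simps)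
qed

lemma (in group) tensorQ_gen_inv:
  assumes "a \<in> carrier G"
  shows "tensorQ_gen (inv a) + tensorQ_gen a \<in> tensorQ_relations G"
proof -
  have "tensorQ_gen \<one> - (tensorQ_gen (inv a \<otimes> a) - tensorQ_gen (inv a) - tensorQ_gen a) \<in> tensorQ_relations G"
    by (intro tensorQ_relations_diff tensorQ_gen_one tensorQ_gen_mult inv_closed assms)
  then show ?thesis
    using assms by (simp add: add.commute)
qed

lemma (in group) tensorQ_gen_int_pow:
  assumes "a \<in> carrier G"
  shows "tensorQ_gen (a [^] (m::int)) - qscale (of_int m) (tensorQ_gen a) \<in> tensorQ_relations G"
proof (cases m rule: int_cases2)
  case (nonneg n)
  then show ?thesis
    using tensorQ_gen_nat_pow[OF assms, of n] by (simp add: int_pow_int)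
next
  case (nonpos n)
  have "(tensorQ_gen (inv (a [^] n)) + tensorQ_gen (a [^] n))
      - (tensorQ_gen (a [^] n) - qscale (of_nat n) (tensorQ_gen a)) \<in> tensorQ_relations G"
    by (rule tensorQ_relations_diff[OF tensorQ_gen_inv[OF nat_pow_closed[OF assms]] tensorQ_gen_nat_pow[OF assms]])
  then show ?thesis
    using assms nonpos by (simp add: int_pow_neg_int qscale.scale_minus_left)
qed

text \<open>Modulo relations, \<open>n\<close> times the generator of \<open>a\<close> is the
  generator of the neutral element, hence 0, and \<open>n\<close> is invertible in the
  rationals.\<close>

lemma (in group) tensorQ_gen_torsion:
  assumes "a \<in> carrier G" "n > 0" "a [^] (n::nat) = \<one>"
  shows "tensorQ_gen a \<in> tensorQ_relations G"
proof -
  have "qscale (of_nat n) (tensorQ_gen a) \<in> tensorQ_relations G"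
    using tensorQ_relations_diff[OF tensorQ_gen_one tensorQ_gen_nat_pow[OF assms(1), of n]] assms(3)
    by simp
  then have "qscale (1 / of_nat n) (qscale (of_nat n) (tensorQ_gen a)) \<in> tensorQ_relations G"
    by (rule tensorQ_relations_scale)
  then show ?thesis
    using assms(2) by (simp add: qscale.scale_scale)
qed

lemma (in group) torsion_imp_not_tensorQ_dim_eq_1:
  assumes "\<And>a. a \<in> carrier G \<Longrightarrow> \<exists>n>0. a [^] (n::nat) = \<one>"
  shows "\<not> tensorQ_dim_eq G 1"
proof
  assume "tensorQ_dim_eq G 1"
  then obtain B where B: "B \<subseteq> tensorQ_free G" "card B = 1"
    "\<And>c. (\<Sum>b\<in>B. qscale (c b) b) \<in> tensorQ_relations G \<Longrightarrow> \<forall>b\<in>B. c b = 0"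
    unfolding tensorQ_dim_eq_def by blast
  then obtain b where b: "B = {b}"
    by (meson card_1_singletonE)
  \<comment> \<open>All generators are relations, so the supposed basis element is one too, against
    its independence.\<close>
  have "\<exists>d. b - qscale d 0 \<in> tensorQ_relations G"
    by (rule tensorQ_free_sum_relations[where c = "\<lambda>_. 0"])
      (use assms tensorQ_gen_torsion B b in auto)
  then have "(\<Sum>b\<in>B. qscale ((\<lambda>_. 1) b) b) \<in> tensorQ_relations G"
    by (simp add: b)
  from B(3)[OF this] show False
    by (simp add: b)
qed

text \<open>The rational-linear extension \<open>H\<close> of \<open>h\<close> kills all relations
  but not the generator of \<open>a\<close>, which is therefore independent. It also spans:
  \<open>g [^] h a\<close> and \<open>a [^] h g\<close> have the same image under \<open>h\<close>,
  so they differ by a torsion element, and \<open>h a\<close> times the generator of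
  \<open>g\<close> is congruent to \<open>h g\<close> times that of \<open>a\<close>.\<close>

lemma (in comm_group) tensorQ_dim_eq_1:
  fixes h :: "'a \<Rightarrow> int"
  assumes h: "\<And>x y. x \<in> carrier G \<Longrightarrow> y \<in> carrier G \<Longrightarrow> h (x \<otimes> y) = h x + h y"
    and a: "a \<in> carrier G" "h a \<noteq> 0"
    and torsion: "\<And>x. x \<in> carrier G \<Longrightarrow> h x = 0 \<Longrightarrow> \<exists>n>0. x [^] (n::nat) = \<one>"
  shows "tensorQ_dim_eq G 1"
proof -
  define H :: "('a \<Rightarrow>\<^sub>0 rat) \<Rightarrow> rat" where "H f = (\<Sum>x\<in>Poly_Mapping.keys f. Poly_Mapping.lookup f x * of_int (h x))" for f
  have H_superset: "H f = (\<Sum>x\<in>S. Poly_Mapping.lookup f x * of_int (h x))"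
    if "finite S" "Poly_Mapping.keys f \<subseteq> S" for f S
    unfolding H_def using that by (intro sum.mono_neutral_left) (auto simp: in_keys_iff)
  have H_add: "H (f + g) = H f + H g" for f g
  proof -
    let ?S = "Poly_Mapping.keys f \<union> Poly_Mapping.keys g"
    have "Poly_Mapping.keys (f + g) \<subseteq> ?S"
      by (rule Poly_Mapping.keys_add)
    then show ?thesis
      by (simp add: H_superset[of ?S] lookup_add distrib_right sum.distrib)
  qed
  have H_scale: "H (qscale c f) = c * H f" for c f
  proof -
    have "Poly_Mapping.keys (qscale c f) \<subseteq> Poly_Mapping.keys f"
      by (auto simp: in_keys_iff)
    then show ?thesis
      by (simp add: H_superset[of "Poly_Mapping.keys f"] sum_distrib_left mult.assoc)
  qed
  have H_gen: "H (tensorQ_gen x) = of_int (h x)" for x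
    by (simp add: H_def)
  have H_diff: "H (f - g) = H f - H g" for f g
    using H_add[of "f - g" g] by simp
  have H_relations: "H f = 0" if "f \<in> tensorQ_relations G" for f
    using that unfolding tensorQ_relations_def
  proof (induction rule: qscale.span_induct_alt)
    case base
    show ?case
      by (simp add: H_def)
  next
    case (step c x y)
    then show ?case
      by (auto simp: H_add H_scale H_diff H_gen h)
  qed
  have int_pow: "h (x [^] (m::int)) = m * h x" if x: "x \<in> carrier G" for x m
  proof -
    have one: "h \<one> = 0"
      using h[of \<one> \<one>] by simp
    have nat: "h (x [^] (n::nat)) = int n * h x" for n
      using x by (induction n) (auto simp: one h algebra_simps)
    have inv: "h (inv y) = - h y" if "y \<in> carrier G" for y
      using h[of "inv y" y] that one by simp
    show ?thesis
      using x by (cases m rule: int_cases2) (simp_all add: int_pow_int int_pow_neg_int nat inv)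
  qed
  have gen: "tensorQ_gen g - qscale (of_int (h g) / of_int (h a)) (tensorQ_gen a) \<in> tensorQ_relations G"
    if g: "g \<in> carrier G" for g
  proof -
    let ?R = "tensorQ_relations G" and ?x = "g [^] h a" and ?y = "a [^] h g"
    have xy: "?x \<in> carrier G" "?y \<in> carrier G"
      using g a by auto
    have "h ?x = h (?x \<otimes> inv ?y) + h ?y"
      using xy h[of "?x \<otimes> inv ?y" ?y] by (simp add: m_assoc)
    then have "h (?x \<otimes> inv ?y) = 0"
      using g a by (simp add: int_pow)
    then obtain n where n: "n > 0" "(?x \<otimes> inv ?y) [^] (n::nat) = \<one>"
      using torsion[of "?x \<otimes> inv ?y"] xy by auto
    have 1: "tensorQ_gen (?x \<otimes> inv ?y) \<in> ?R"
      by (rule tensorQ_gen_torsion[OF _ n]) (use xy in auto)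
    have 2: "tensorQ_gen ?x - tensorQ_gen (?x \<otimes> inv ?y) - tensorQ_gen ?y \<in> ?R"
      using tensorQ_gen_mult[of "?x \<otimes> inv ?y" ?y] xy by (simp add: m_assoc)
    \<comment> \<open>All generators of \<open>?x\<close>, \<open>?y\<close> and their quotient
      cancel; what remains is \<open>h a\<close> times the generator of \<open>g\<close> minus
      \<open>h g\<close> times that of \<open>a\<close>.\<close>
    have "(tensorQ_gen ?x - tensorQ_gen (?x \<otimes> inv ?y) - tensorQ_gen ?y) + tensorQ_gen (?x \<otimes> inv ?y)
        - (tensorQ_gen ?x - qscale (of_int (h a)) (tensorQ_gen g))
        + (tensorQ_gen ?y - qscale (of_int (h g)) (tensorQ_gen a)) \<in> ?R"
      using tensorQ_relations_add[OF tensorQ_relations_diff[OF tensorQ_relations_add[OF 2 1]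
          tensorQ_gen_int_pow[OF g]] tensorQ_gen_int_pow[OF a(1)]] .
    then have "qscale (1 / of_int (h a)) (qscale (of_int (h a)) (tensorQ_gen g) - qscale (of_int (h g)) (tensorQ_gen a)) \<in> ?R"
      by (intro tensorQ_relations_scale) simp
    then show ?thesis
      using a by (simp add: qscale.scale_right_diff_distrib qscale.scale_scale)
  qed
  show ?thesis
    unfolding tensorQ_dim_eq_def
  proof (intro exI[of _ "{tensorQ_gen a}"] conjI allI impI ballI)
    fix c b
    assume "(\<Sum>b\<in>{tensorQ_gen a}. qscale (c b) b) \<in> tensorQ_relations G" "b \<in> {tensorQ_gen a}"
    then show "c b = 0"
      using H_relations[of "qscale (c (tensorQ_gen a)) (tensorQ_gen a)"] a
      by (simp add: H_scale H_gen)
  next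
    fix f
    assume "f \<in> tensorQ_free G"
    then obtain d where "f - qscale d (tensorQ_gen a) \<in> tensorQ_relations G"
      using tensorQ_free_sum_relations[OF gen] by blast
    then show "\<exists>c. f - (\<Sum>b\<in>{tensorQ_gen a}. qscale (c b) b) \<in> tensorQ_relations G"
      by (intro exI[of _ "\<lambda>_. d"]) simp
  qed (use a in \<open>auto simp: tensorQ_free_def\<close>)
qed

definition additive_subgroup :: "'g::ab_group_add set \<Rightarrow> bool" where
  "additive_subgroup G \<longleftrightarrow> 0 \<in> G \<and> (\<forall>x\<in>G. \<forall>y\<in>G. x + y \<in> G) \<and> (\<forall>x\<in>G. - x \<in> G)"

lemma group_on_simps [simp]:
  "carrier (group_on G) = G" "x \<otimes>\<^bsub>group_on G\<^esub> y = x + y" "\<one>\<^bsub>group_on G\<^esub> = 0"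
  by (simp_all add: group_on_def)

lemma group_on_pow [simp]: "x [^]\<^bsub>group_on G\<^esub> (n::nat) = (\<Sum>i<n. x)"
  by (induction n) (simp_all add: nat_pow_def add.commute)

lemma comm_group_group_on:
  assumes "additive_subgroup G"
  shows "comm_group (group_on G)"
  using assms unfolding additive_subgroup_def
  by (intro comm_groupI) (auto simp: add_ac intro: bexI[of _ "- _"])

text \<open>Both criteria descend to the quotient: a multiple lying in \<open>H\<close> becomes
  trivial there, and a homomorphism that kills \<open>H\<close> factors through it. Multiples are
  written as constant sums, the form of powers in \<open>group_on\<close>.\<close>

lemma
  fixes G H :: "'g::ab_group_add set"
  assumes G: "additive_subgroup G" and H: "additive_subgroup H" "H \<subseteq> G"
  shows torsion_Mod_imp_not_tensorQ_dim_eq_1: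
      "(\<And>g. g \<in> G \<Longrightarrow> \<exists>n>0. (\<Sum>i<n::nat. g) \<in> H) \<Longrightarrow>
       \<not> tensorQ_dim_eq (group_on G Mod H) 1"
    and tensorQ_dim_eq_1_ModI:
      "(\<And>x y. x \<in> G \<Longrightarrow> y \<in> G \<Longrightarrow> h (x + y) = h x + h y) \<Longrightarrow>
       (\<And>x. x \<in> H \<Longrightarrow> h x = (0::int)) \<Longrightarrow> a \<in> G \<Longrightarrow> h a \<noteq> 0 \<Longrightarrow>
       (\<And>g. g \<in> G \<Longrightarrow> h g = 0 \<Longrightarrow> \<exists>n>0. (\<Sum>i<n::nat. g) \<in> H) \<Longrightarrow>
       tensorQ_dim_eq (group_on G Mod H) 1"
proof -
  interpret G: comm_group "group_on G"
    by (rule comm_group_group_on) fact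
  have inv: "inv\<^bsub>group_on G\<^esub> x = - x" if "x \<in> G" for x
    using G that by (intro G.inv_equality) (auto simp: additive_subgroup_def)
  have "subgroup H (group_on G)"
    using G H inv by (intro G.subgroupI) (auto simp: additive_subgroup_def)
  then have "H \<lhd> group_on G"
    by (rule G.subgroup_imp_normal)
  then interpret H: normal H "group_on G" .
  let ?A = "group_on G Mod H" and ?\<pi> = "\<lambda>x. H #>\<^bsub>group_on G\<^esub> x"
  interpret A: comm_group ?A
    by (rule G.abelian_FactGroup) fact
  have \<pi>: "?\<pi> \<in> hom (group_on G) ?A"
    by (rule H.r_coset_hom_Mod)
  then interpret \<pi>: group_hom "group_on G" ?A ?\<pi>
    by unfold_locales
  have carrier: "carrier ?A = ?\<pi> ` G"
    by (auto simp: FactGroup_def RCOSETS_def)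
  have pow: "?\<pi> x [^]\<^bsub>?A\<^esub> n = \<one>\<^bsub>?A\<^esub>" if "x \<in> G" "(\<Sum>i<n::nat. x) \<in> H" for x n
    using that \<pi>.hom_nat_pow[of x n] H.rcos_const[of "\<Sum>i<n. x"] by simp
  show "\<not> tensorQ_dim_eq ?A 1" if "\<And>g. g \<in> G \<Longrightarrow> \<exists>n>0. (\<Sum>i<n::nat. g) \<in> H"
    by (rule A.torsion_imp_not_tensorQ_dim_eq_1) (use carrier pow that in fastforce)
  show "tensorQ_dim_eq ?A 1"
    if h: "\<And>x y. x \<in> G \<Longrightarrow> y \<in> G \<Longrightarrow> h (x + y) = h x + h y"
      and h0: "\<And>x. x \<in> H \<Longrightarrow> h x = (0::int)"
      and a: "a \<in> G" "h a \<noteq> 0"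
      and torsion: "\<And>g. g \<in> G \<Longrightarrow> h g = 0 \<Longrightarrow> \<exists>n>0. (\<Sum>i<n::nat. g) \<in> H"
  proof -
    \<comment> \<open>As \<open>h\<close> kills \<open>H\<close>, it is constant on each coset, so
      its image of a coset is a singleton.\<close>
    define h' where "h' C = the_elem (h ` C)" for C
    have "h ` ?\<pi> x = {h x}" if "x \<in> G" for x
    proof -
      have "?\<pi> x = (\<lambda>y. y + x) ` H"
        by (auto simp: r_coset_def)
      moreover have "h (y + x) = h x" if "y \<in> H" for y
        using h[of y x] h0 H(2) that \<open>x \<in> G\<close> by auto
      moreover have "H \<noteq> {}"
        using H.one_closed by auto
      ultimately show ?thesis
        by (auto simp: image_image)
    qed
    then have h': "h' (?\<pi> x) = h x" if "x \<in> G" for x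
      using that by (simp add: h'_def)
    show ?thesis
    proof (rule A.tensorQ_dim_eq_1[of h' "?\<pi> a"])
      fix x y
      assume "x \<in> carrier ?A" "y \<in> carrier ?A"
      then obtain x' y' where xy: "x = ?\<pi> x'" "y = ?\<pi> y'" "x' \<in> G" "y' \<in> G"
        using carrier by auto
      then have "x \<otimes>\<^bsub>?A\<^esub> y = ?\<pi> (x' + y')"
        using \<pi>.hom_mult[of x' y'] by simp
      moreover have "x' + y' \<in> G"
        using xy G by (simp add: additive_subgroup_def)
      ultimately show "h' (x \<otimes>\<^bsub>?A\<^esub> y) = h' x + h' y"
        using xy h by (simp add: h')
    next
      fix x
      assume "x \<in> carrier ?A" "h' x = 0"
      then obtain x' where x': "x = ?\<pi> x'" "x' \<in> G"
        using carrier by auto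
      then obtain n where "n > 0" "(\<Sum>i<n::nat. x') \<in> H"
        using torsion[of x'] h'[of x'] \<open>h' x = 0\<close> by auto
      then show "\<exists>n>0. x [^]\<^bsub>?A\<^esub> (n::nat) = \<one>\<^bsub>?A\<^esub>"
        using pow x' by blast
    qed (use a h' carrier in auto)
  qed
qed

section \<open>Algebraic residue field extensions\<close>

lemma ring_on_pow [simp]: "x [^]\<^bsub>ring_on S\<^esub> (n::nat) = x ^ n"
  by (induction n) (simp_all add: nat_pow_def ac_simps)

text \<open>\<open>normalize\<close> strips leading zeros from a coefficient list. This turns a
  vanishing reduced polynomial into vanishing of each reduced coefficient.\<close>

lemma (in ring) normalize_eq_Nil_imp_zero:
  assumes "normalize p = []" "x \<in> set p"
  shows "x = \<zero>"
proof -
  have "p = replicate (length p) \<zero>"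
    using normalize_trick[of p] assms(1) by simp
  then show ?thesis
    using assms(2) by (metis in_set_replicate)
qed

lemma (in ring_hom_cring) eval_map_hom:
  assumes "set cs \<subseteq> carrier R" "x \<in> carrier R"
  shows "ring.eval S (map h cs) (h x) = h (ring.eval R cs x)"
  using assms(1)
proof (induction cs)
  case Nil
  then show ?case
    by (simp add: R.eval.simps S.eval.simps)
next
  case (Cons c cs)
  then show ?case
    using assms(2) R.eval_in_carrier[of cs x] by (simp add: hom_mult hom_add)
qed

text \<open>HOL-Algebra lists coefficients from the leading one down, \<open>Poly\<close> from the
  constant one up, hence \<open>rev\<close>.\<close>

lemma ring_on_eval:
  assumes "ring (ring_on S)"
  shows "ring.eval (ring_on S) cs x = poly (Poly (rev cs)) x"
proof -
  interpret ring "ring_on S"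
    by fact
  show ?thesis
    by (induction cs) (simp_all add: Poly_append poly_monom algebra_simps)
qed

lemma set_coeffs_subset: "set (coeffs p) \<subseteq> range (poly.coeff p)"
  by (auto simp: coeffs_def split: if_splits)

text \<open>The assumed polynomial has integral coefficients, one of them a unit, so its reduction
  is nonzero; it vanishes at the residue of \<open>f\<close>. Every residue is thus algebraic over
  the residue subfield, and no single residue can be a transcendence basis.\<close>

lemma (in valued_field) residue_not_trdeg_eq_1:
  assumes E: "is_subfield E" "k \<subseteq> E"
    and alg: "\<And>f. f \<in> E \<Longrightarrow> 0 \<le> v f \<Longrightarrow>
      \<exists>p. (\<forall>i. poly.coeff p i \<in> k \<and> 0 \<le> v (poly.coeff p i)) \<and> (\<exists>i. v (poly.coeff p i) = 0) \<and>
        0 < v (poly p f)"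
  shows "\<not> trdeg_eq (residue_field E v) (residue_subfield E v k) 1"
proof
  let ?V = "{x \<in> E. 0 \<le> v x}" and ?I = "valuation_ideal E v"
  let ?R = "valuation_ring E v" and ?L = "residue_field E v"
  let ?\<pi> = "\<lambda>x. ?I +>\<^bsub>?R\<^esub> x"
  note E_simps = is_subfieldD[OF E(1)]
  have R: "cring ?R"
    unfolding valuation_ring_def
    by (rule cring_ring_on) (auto simp: E_simps v_nonneg_add v_nonneg_mult)
  then interpret R: cring ?R .
  have "ideal ?I ?R"
  proof (rule idealI)
    show "subgroup ?I (add_monoid ?R)"
    proof (rule R.add.subgroupI)
      show "\<ominus>\<^bsub>?R\<^esub> x \<in> ?I" if "x \<in> ?I" for x
      proof -
        have "\<ominus>\<^bsub>?R\<^esub> x = - x"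
          using that by (intro R.minus_equality)
            (auto simp: valuation_ring_def valuation_ideal_def E_simps)
        then show ?thesis
          using that by (simp add: valuation_ideal_def E_simps)
      qed
    qed (auto simp: valuation_ring_def valuation_ideal_def E_simps v_add_less zero_extended_def
        intro!: exI[of _ 0])
  next
    fix x y
    assume "x \<in> ?I" "y \<in> carrier ?R"
    then show "y \<otimes>\<^bsub>?R\<^esub> x \<in> ?I" "x \<otimes>\<^bsub>?R\<^esub> y \<in> ?I"
      using v_nonneg_mult_pos[of y x] by (auto simp: valuation_ring_def valuation_ideal_def E_simps mult.commute)
  qed (rule R.ring_axioms)
  then interpret I: ideal ?I ?R .
  have L: "cring ?L"
    unfolding residue_field_def by (rule I.quotient_is_cring[OF R])
  then interpret L: cring ?L .
  have hom: "?\<pi> \<in> ring_hom ?R ?L"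
    unfolding residue_field_def by (rule I.rcos_ring_hom)
  then interpret \<pi>: ring_hom_cring ?R ?L ?\<pi>
    by unfold_locales
  have carrier_R: "carrier ?R = ?V"
    by (simp add: valuation_ring_def)
  have \<pi>_eq_0: "?\<pi> x = \<zero>\<^bsub>?L\<^esub> \<longleftrightarrow> 0 < v x" if "x \<in> ?V" for x
  proof -
    have "?\<pi> x = \<zero>\<^bsub>?L\<^esub> \<longleftrightarrow> x \<in> ?I"
      using that I.rcos_const_imp_mem[of x] I.a_rcos_const[of x]
      by (auto simp: residue_field_def FactRing_def valuation_ring_def)
    then show ?thesis
      using that by (simp add: valuation_ideal_def)
  qed
  assume "trdeg_eq ?L (residue_subfield E v k) 1"
  then obtain S where S: "S \<subseteq> carrier ?L" "card S = 1"
    "\<And>s. s \<in> S \<Longrightarrow> L.transcendental (generate_field ?L (residue_subfield E v k \<union> (S - {s}))) s"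
    unfolding trdeg_eq_def by blast
  then obtain s where s: "S = {s}"
    by (meson card_1_singletonE)
  define F where "F = generate_field ?L (residue_subfield E v k)"
  have "s \<in> carrier ?L"
    using S s by simp
  then obtain f where f: "f \<in> ?V" "s = ?\<pi> f"
    by (auto simp: residue_field_def FactRing_def A_RCOSETS_def' valuation_ring_def)
  then obtain p i where p: "\<And>i. poly.coeff p i \<in> k" "\<And>i. 0 \<le> v (poly.coeff p i)"
    "v (poly.coeff p i) = 0" "0 < v (poly p f)"
    using alg[of f] by auto
  define cs where "cs = rev (coeffs p)"
  have cs: "set cs \<subseteq> ?V"
    using p set_coeffs_subset[of p] E(2) by (fastforce simp: cs_def)
  \<comment> \<open>Leading coefficients may reduce to zero, so the reduced list must be normalized
    before it counts as a polynomial.\<close>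
  have "L.eval (L.normalize (map ?\<pi> cs)) s = L.eval (map ?\<pi> cs) s"
  proof (rule L.eval_normalize)
    show "set (map ?\<pi> cs) \<subseteq> carrier ?L"
      using cs carrier_R \<pi>.hom_closed by auto
    show "s \<in> carrier ?L"
      by fact
  qed
  also have "\<dots> = ?\<pi> (R.eval cs f)"
    unfolding f(2) using cs f by (intro \<pi>.eval_map_hom) (auto simp: carrier_R)
  also have "R.eval cs f = poly p f"
    using R.ring_axioms unfolding valuation_ring_def by (simp add: ring_on_eval cs_def)
  also have "?\<pi> (poly p f) = \<zero>\<^bsub>?L\<^esub>"
  proof -
    have "R.eval cs f \<in> carrier ?R"
      using cs f by (intro R.eval_in_carrier) (auto simp: carrier_R)
    then show ?thesis
      using \<open>R.eval cs f = poly p f\<close> p(4) \<pi>_eq_0[of "poly p f"] by (simp add: valuation_ring_def)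
  qed
  finally have "L.eval (L.normalize (map ?\<pi> cs)) s = L.eval [] s"
    by simp
  moreover have "L.normalize (map ?\<pi> cs) \<in> carrier (F [X]\<^bsub>?L\<^esub>)"
  proof -
    have "set (map ?\<pi> cs) \<subseteq> residue_subfield E v k"
      using cs p(1) set_coeffs_subset[of p] by (fastforce simp: residue_subfield_def cs_def)
    also have "\<dots> \<subseteq> F"
      by (auto simp: F_def intro: generate_field.incl)
    finally show ?thesis
      unfolding univ_poly_def using L.normalize_gives_polynomial by simp
  qed
  moreover have "[] \<in> carrier (F [X]\<^bsub>?L\<^esub>)"
    by (simp add: univ_poly_def polynomial_def)
  moreover have "L.transcendental F s"
    using S(3)[of s] s by (simp add: F_def)
  \<comment> \<open>Transcendence is injectivity of evaluation, so a polynomial vanishing at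
    \<open>s\<close> equals the zero polynomial \<open>[]\<close>.\<close>
  ultimately have "L.normalize (map ?\<pi> cs) = []"
    unfolding L.transcendental_def inj_on_def by blast
  moreover have "poly.coeff p i \<in> set cs"
  proof -
    have "poly.coeff p i \<noteq> 0"
      using p(3) by (auto simp: zero_extended_def)
    then show ?thesis
      using coeff_in_coeffs[of p i] Polynomial.le_degree[of p i] by (cases "p = 0") (auto simp: cs_def)
  qed
  ultimately have "?\<pi> (poly.coeff p i) = \<zero>\<^bsub>?L\<^esub>"
    using L.normalize_eq_Nil_imp_zero by (metis image_eqI set_map)
  then show False
    using \<pi>_eq_0[of "poly.coeff p i"] p(3) cs \<open>poly.coeff p i \<in> set cs\<close> by auto
qed

section \<open>Rational function fields and cofinal sequences\<close>

lemma cst_1: "cst 1 = 1"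
  by (simp add: One_fract_def pCons_one)

lemma cst_eq_0_iff: "cst c = 0 \<longleftrightarrow> c = 0"
  by (simp add: eq_fract Zero_fract_def)

lemma cst_add: "cst (c + d) = cst c + cst d"
  by simp

lemma cst_diff: "cst (c - d) = cst c - cst d"
  by simp

lemma cst_mult: "cst (c * d) = cst c * cst d"
  by (simp add: mult.commute[of d c])

lemma cst_inverse: "cst (inverse c) = inverse (cst c)"
proof (cases "c = 0")
  case False
  then have "cst c * cst (inverse c) = 1"
    by (simp only: cst_1 flip: cst_mult) (simp add: cst_1)
  then show ?thesis
    by (rule inverse_unique[symmetric])
qed (simp add: fract_collapse)

lemma ratfuns_UNIV [simp]: "ratfuns UNIV = UNIV"
proof (rule UNIV_eq_I[symmetric])
  fix x :: "'a poly fract"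
  obtain p q where "x = Fract p q" "q \<noteq> 0"
    by (rule Fract_cases)
  then show "x \<in> ratfuns UNIV"
    unfolding ratfuns_def by blast
qed

lemma cst_in_ratfuns: "is_subfield F \<Longrightarrow> c \<in> F \<Longrightarrow> cst c \<in> ratfuns F"
proof -
  assume F: "is_subfield F" and c: "c \<in> F"
  have "poly.coeff [:c:] i \<in> F" "poly.coeff 1 i \<in> F" for i
    using c is_subfieldD[OF F] by (auto simp: coeff_pCons split: nat.splits)
  moreover have "(1::'a poly) \<noteq> 0"
    by simp
  ultimately show ?thesis
    unfolding ratfuns_def by blast
qed

lemma is_subfield_ratfuns:
  assumes "is_subfield F"
  shows "is_subfield (ratfuns F)"
proof -
  note F = is_subfieldD[OF assms]
  let ?P = "{p. \<forall>i. poly.coeff p i \<in> F}"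
  have P: "p + q \<in> ?P" "p * q \<in> ?P" "- p \<in> ?P" if "p \<in> ?P" "q \<in> ?P" for p q
    using that F by (auto simp: coeff_mult intro!: is_subfield_sum[OF assms])
  have ratfuns: "ratfuns F = {Fract p q | p q. p \<in> ?P \<and> q \<in> ?P \<and> q \<noteq> 0}"
    by (auto simp: ratfuns_def)
  show ?thesis
  proof (rule is_subfieldI)
    show "1 \<in> ratfuns F"
      using cst_in_ratfuns[OF assms F(2)] by (simp only: cst_1)
  next
    fix x y
    assume "x \<in> ratfuns F" "y \<in> ratfuns F"
    then obtain p q r s where pq: "x = Fract p q" "y = Fract r s" "p \<in> ?P" "q \<in> ?P" "r \<in> ?P" "s \<in> ?P"
      "q \<noteq> 0" "s \<noteq> 0"
      unfolding ratfuns by blast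
    have "x + y = Fract (p * s + r * q) (q * s)" "x * y = Fract (p * r) (q * s)"
      using pq by simp_all
    moreover have "p * s + r * q \<in> ?P" "q * s \<in> ?P" "p * r \<in> ?P" "q * s \<noteq> 0"
      using P pq by (blast, blast, blast, simp)
    ultimately show "x + y \<in> ratfuns F" "x * y \<in> ratfuns F"
      unfolding ratfuns by blast+
  next
    fix x
    assume "x \<in> ratfuns F"
    then obtain p q where pq: "x = Fract p q" "p \<in> ?P" "q \<in> ?P" "q \<noteq> 0"
      unfolding ratfuns by blast
    moreover have "- x = Fract (- p) q"
      using pq by simp
    ultimately show "- x \<in> ratfuns F"
      using P(3)[of p p] unfolding ratfuns by blast
    show "inverse x \<in> ratfuns F" if "x \<noteq> 0"
    proof -
      have "p \<noteq> 0"
        using pq that by (auto simp: fract_collapse)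
      moreover have "inverse x = Fract q p"
        using pq by simp
      ultimately show ?thesis
        using pq unfolding ratfuns by blast
    qed
  qed
qed

section \<open>Value groups, and polynomials modulo the valuation ideal\<close>

context valued_field
begin

lemma additive_subgroup_value_group:
  assumes "is_subfield F"
  shows "additive_subgroup (value_group F v)"
  unfolding additive_subgroup_def
proof (intro conjI ballI)
  show "0 \<in> value_group F v"
    using is_subfieldD(2)[OF assms] by (auto simp: value_group_def zero_extended_def intro: bexI[of _ 1])
  show "g + h \<in> value_group F v" if "g \<in> value_group F v" "h \<in> value_group F v" for g h
  proof -
    obtain x y where "x \<in> F" "y \<in> F" "v x = Fin g" "v y = Fin h"
      using \<open>g \<in> value_group F v\<close> \<open>h \<in> value_group F v\<close> by (auto simp: value_group_def)
    then have "x * y \<in> F" "v (x * y) = Fin (g + h)"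
      by (simp_all add: is_subfieldD[OF assms] v_mult)
    then show ?thesis
      by (auto simp: value_group_def)
  qed
  show "- g \<in> value_group F v" if "g \<in> value_group F v" for g
    using that is_subfieldD(6)[OF assms] v_inverse unfolding value_group_def by blast
qed

lemma v_power: "v x = Fin \<delta> \<Longrightarrow> v (x ^ n) = Fin (\<Sum>i<n. \<delta>)"
  by (induction n) (simp_all add: v_mult zero_extended_def add.commute)

lemma v_power_diff_pos:
  assumes "0 \<le> v x" "0 \<le> v y" "0 < v (x - y)"
  shows "0 < v (x ^ n - y ^ n)"
proof (induction n)
  case (Suc n)
  have "x ^ Suc n - y ^ Suc n = x * (x ^ n - y ^ n) + y ^ n * (x - y)"
    by (simp add: algebra_simps)
  then show ?case
    using assms Suc by (auto intro!: v_add_less v_nonneg_mult_pos v_nonneg_power)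
qed (simp add: zero_extended_def)

text \<open>Polynomials with integral coefficients preserve congruence modulo the valuation ideal,
  so \<open>p(x)\<close> is congruent to \<open>p(y) = 0\<close>. No residue field has to be
  formed.\<close>

lemma v_poly_pos:
  assumes "0 \<le> v x" "0 \<le> v y" "0 < v (x - y)" "\<And>i. 0 \<le> v (poly.coeff p i)" "poly p y = 0"
  shows "0 < v (poly p x)"
proof -
  have "poly p x = poly p x - poly p y"
    using assms by simp
  also have "\<dots> = (\<Sum>i\<le>Polynomial.degree p. poly.coeff p i * (x ^ i - y ^ i))"
    by (simp add: poly_altdef sum_subtractf right_diff_distrib)
  also have "0 < v \<dots>"
    unfolding zero_extended_def using assms
    by (intro v_sum_greater) (auto simp flip: zero_extended_def intro!: v_nonneg_mult_pos v_power_diff_pos)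
  finally show ?thesis .
qed

text \<open>Dividing by a coefficient of minimal value makes all coefficients integral and one a
  unit, so the reduction of the polynomial is nonzero.\<close>

lemma alg_cl_normalized:
  assumes "is_subfield F" "x \<in> alg_cl F"
  obtains p i where "\<And>i. poly.coeff p i \<in> F" "poly p x = 0" "\<And>i. 0 \<le> v (poly.coeff p i)"
    "v (poly.coeff p i) = 0"
proof -
  obtain p where p: "p \<noteq> 0" "\<forall>i. poly.coeff p i \<in> F" "poly p x = 0"
    using assms by (auto simp: alg_cl_def)
  let ?A = "{..Polynomial.degree p}"
  have "Min ((\<lambda>i. v (poly.coeff p i)) ` ?A) \<in> (\<lambda>i. v (poly.coeff p i)) ` ?A"
    by (intro Min_in) auto
  then obtain k where k: "Min ((\<lambda>i. v (poly.coeff p i)) ` ?A) = v (poly.coeff p k)"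
    by (rule imageE)
  have min: "v (poly.coeff p k) \<le> v (poly.coeff p i)" for i
  proof (cases "i \<le> Polynomial.degree p")
    case True
    then show ?thesis
      unfolding k[symmetric] by (intro Min_le) auto
  qed (simp add: coeff_eq_0)
  have "poly.coeff p k \<noteq> 0"
    using min[of "Polynomial.degree p"] p(1) by (metis leading_coeff_0_iff Pinf_le v_eq_Pinf_iff(1))
  then obtain \<delta> where \<delta>: "v (poly.coeff p k) = Fin \<delta>"
    using v_finite by metis
  show thesis
  proof (rule that[of "Polynomial.smult (inverse (poly.coeff p k)) p" k])
    show "0 \<le> v (poly.coeff (Polynomial.smult (inverse (poly.coeff p k)) p) i)" for i
      using min[of i] \<delta> v_inverse[OF \<delta>] by (cases "v (poly.coeff p i)") (simp_all add: v_mult zero_extended_def)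
  qed (use p \<open>poly.coeff p k \<noteq> 0\<close> is_subfieldD[OF assms(1)] in auto)
qed

end

text \<open>The case \<open>n = 1\<close> with coefficients \<open>c\<close> and 1. Taking
  \<open>c = 0\<close> gives the value of \<open>X - a\<close>; other \<open>c\<close> serve to
  refute candidates for a pair of definition.\<close>

lemma is_v_a_gamma_linear:
  assumes "is_v_a_gamma F u a \<gamma> w" "c \<in> F" "1 \<in> F" "u 1 = 0"
  shows "w (cst c + (XX - cst a)) = min (u c) (Fin \<gamma>)"
proof -
  define C where "C i = (if i = 0 then c else 1)" for i :: nat
  have "\<forall>i\<le>1. C i \<in> F"
    using assms by (simp add: C_def)
  then have "w (\<Sum>i\<le>1. cst (C i) * (XX - cst a) ^ i) = Min ((\<lambda>i. u (C i) + Fin (\<Sum>j<i. \<gamma>)) ` {..1})"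
    using assms(1) unfolding is_v_a_gamma_def by blast
  then show ?thesis
    using assms(4) by (simp add: C_def atMost_Suc zero_extended_def[symmetric] min.commute)
qed

lemma limit_index_next:
  assumes "limit_index I" "i \<in> I"
  shows "next_index I i \<in> I" "i < next_index I i"
proof -
  have "{j \<in> I. i < j} \<subseteq> I" "{j \<in> I. i < j} \<noteq> {}"
    using assms by (auto simp: limit_index_def)
  then obtain m where m: "m \<in> {j \<in> I. i < j}" "\<forall>s\<in>{j \<in> I. i < j}. m \<le> s"
    using assms(1) unfolding limit_index_def by metis
  then have "next_index I i = m"
    unfolding next_index_def by (intro Least_equality) auto
  then show "next_index I i \<in> I" "i < next_index I i"
    using m by auto
qed

text \<open>The indices are the elements that exceed all earlier ones in some well-order of the set.\<close>

lemma exists_cofinal_limit_index: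
  fixes S :: "'g::linorder set"
  assumes "S \<noteq> {}" "\<And>x. x \<in> S \<Longrightarrow> \<exists>y\<in>S. x < y"
  obtains I where "limit_index I" "I \<subseteq> S" "\<And>x. x \<in> S \<Longrightarrow> \<exists>i\<in>I. x \<le> i"
proof -
  obtain r where r: "well_order_on S r"
    using well_order_on by blast
  have min: "\<exists>m\<in>T. \<forall>y\<in>T. y \<noteq> m \<longrightarrow> (y, m) \<notin> r \<and> (m, y) \<in> r" if T: "T \<subseteq> S" "T \<noteq> {}" for T
  proof -
    have "wf (r - Id)"
      using r by (simp add: well_order_on_def)
    then obtain m where m: "m \<in> T" "\<And>y. (y, m) \<in> r - Id \<Longrightarrow> y \<notin> T"
      using T by (meson ex_in_conv wfE_min)
    moreover have "total_on S r"
      using r by (simp add: well_order_on_def linear_order_on_def)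
    ultimately show ?thesis
      using T unfolding total_on_def by (intro bexI[of _ m]) blast+
  qed
  define I where "I = {x \<in> S. \<forall>y\<in>S. (y, x) \<in> r \<and> y \<noteq> x \<longrightarrow> y < x}"
  have cofinal: "\<exists>i\<in>I. x \<le> i" if "x \<in> S" for x
  proof -
    \<comment> \<open>The first element \<open>m\<close> of \<open>?T\<close> in the well-order is a
      record: whatever precedes it lies outside \<open>?T\<close>, hence below
      \<open>x \<le> m\<close>.\<close>
    let ?T = "{y \<in> S. x \<le> y}"
    have "?T \<subseteq> S" "?T \<noteq> {}"
      using that by auto
    then obtain m where m: "m \<in> ?T" "\<forall>y\<in>?T. y \<noteq> m \<longrightarrow> (y, m) \<notin> r \<and> (m, y) \<in> r"
      by (meson min)
    have "y < m" if "y \<in> S" "(y, m) \<in> r" "y \<noteq> m" for y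
    proof -
      have "y \<notin> ?T"
        using m that by blast
      then have "y < x"
        using \<open>y \<in> S\<close> by auto
      then show ?thesis
        using m by auto
    qed
    then have "m \<in> I" "x \<le> m"
      using m by (auto simp: I_def)
    then show ?thesis
      by blast
  qed
  have "limit_index I"
    unfolding limit_index_def
  proof (intro conjI allI impI ballI)
    show "I \<noteq> {}"
      using assms(1) cofinal by blast
    show "\<exists>m\<in>T. \<forall>s\<in>T. m \<le> s" if T: "T \<subseteq> I" "T \<noteq> {}" for T
    proof -
      \<comment> \<open>On records the well-order agrees with the order of the type, so its first
        element of \<open>T\<close> is the least.\<close>
      obtain m where m: "m \<in> T" "\<forall>y\<in>T. y \<noteq> m \<longrightarrow> (m, y) \<in> r"
        using min[of T] T unfolding I_def by blast
      have "m \<le> s" if "s \<in> T" for s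
      proof (cases "s = m")
        case False
        then have "(m, s) \<in> r" "m \<in> S" "s \<in> I"
          using m that T I_def by blast+
        then show ?thesis
          using False unfolding I_def by (blast intro: less_imp_le)
      qed simp
      then show ?thesis
        using m by blast
    qed
    show "\<exists>j\<in>I. i < j" if i: "i \<in> I" for i
    proof -
      obtain x where x: "x \<in> S" "i < x"
        using assms(2)[of i] i unfolding I_def by blast
      then obtain j where "j \<in> I" "x \<le> j"
        using cofinal by blast
      then show ?thesis
        using less_le_trans[OF x(2)] by blast
    qed
  qed
  then show thesis
    using that cofinal unfolding I_def by blast
qed

section \<open>A pair of definition of infinite value\<close>

locale infinite_pair =
  fixes v :: "'a::alg_closed_field poly fract \<Rightarrow> 'g::linordered_ab_group_add extended"
    and K Khat :: "'a set" and a :: 'a and \<gamma> :: 'g and \<phi> :: "'g \<Rightarrow> int \<times> 'g"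
  assumes closure: "alg_cl Khat = UNIV"
    and val: "valuation (ring_on UNIV) v"
    and subfields: "is_subfield K" "is_subfield Khat" "K \<subseteq> Khat"
    and dense: "dense_in (ring_on Khat) K (\<lambda>c. v (cst c))"
    and pair: "pair_of_definition Khat v a \<gamma>"
    and ident: "ordered_group_iso \<phi> (value_group UNIV v) (UNIV \<times> value_group (cst ` alg_cl K) v)"
    and ident_\<gamma>: "\<phi> \<gamma> = (1, 0)"
    and ident_K: "\<And>\<alpha>. \<alpha> \<in> value_group (cst ` alg_cl K) v \<Longrightarrow> \<phi> \<alpha> = (0, \<alpha>)"
begin

abbreviation "u c \<equiv> v (cst c)"

sublocale vX: valued_field v
  by unfold_locales (rule val)

sublocale vc: valued_field u
proof
  show "valuation (ring_on UNIV) u"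
    unfolding valuation_def ring_on_simps
  proof (intro conjI ballI)
    show "u (x * y) = u x + u y" "min (u x) (u y) \<le> u (x + y)" for x y
      unfolding cst_mult cst_add by (rule vX.v_mult vX.v_add)+
  qed (simp_all add: cst_eq_0_iff)
qed

lemma alg_cl_K_dense:
  assumes "d \<noteq> 0"
  obtains b where "b \<in> alg_cl K" "u d < u (x - b)"
  using vc.alg_cl_dense[OF alg_closed_imp_poly_has_root subfields dense closure assms] by blast

text \<open>A close enough element of \<open>alg_cl K\<close> has the same value as
  \<open>c\<close>. Thus \<open>ident_K\<close> applies to every constant of the ambient
  field.\<close>

lemma value_group_const: "u c = Fin \<alpha> \<Longrightarrow> \<alpha> \<in> value_group (cst ` alg_cl K) v"
proof -
  assume \<alpha>: "u c = Fin \<alpha>"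
  then have "c \<noteq> 0"
    by (metis extended.distinct(1) vc.v_0)
  then obtain b where b: "b \<in> alg_cl K" "u c < u (c - b)"
    by (rule alg_cl_K_dense)
  then have "u b = u c"
    using vc.v_eqI by blast
  then show ?thesis
    using b \<alpha> by (auto simp: value_group_def)
qed

lemma value_group_UNIVI [intro]: "v x = Fin \<alpha> \<Longrightarrow> \<alpha> \<in> value_group UNIV v"
  by (auto simp: value_group_def)

lemma \<phi>_const: "u c = Fin \<alpha> \<Longrightarrow> \<phi> \<alpha> = (0, \<alpha>)"
  by (rule ident_K[OF value_group_const])

lemma \<phi>_add: "\<alpha> \<in> value_group UNIV v \<Longrightarrow> \<beta> \<in> value_group UNIV v \<Longrightarrow> \<phi> (\<alpha> + \<beta>) = \<phi> \<alpha> + \<phi> \<beta>"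
  using ident by (simp add: ordered_group_iso_def)

lemma \<phi>_less_iff: "\<alpha> \<in> value_group UNIV v \<Longrightarrow> \<beta> \<in> value_group UNIV v \<Longrightarrow> \<phi> \<alpha> < \<phi> \<beta> \<longleftrightarrow> \<alpha> < \<beta>"
  using ident strict_mono_on_less[of "value_group UNIV v" \<phi>] by (simp add: ordered_group_iso_def)

lemma is_v: "is_v_a_gamma UNIV u a \<gamma> v"
  using pair closure by (simp add: pair_of_definition_def)

lemma v_X_minus_a: "v (XX - cst a) = Fin \<gamma>"
  using is_v_a_gamma_linear[OF is_v, of 0] by (simp add: fract_collapse cst_1)

lemma const_less_\<gamma>:
  assumes "c \<noteq> 0"
  shows "u c < Fin \<gamma>"
proof -
  obtain \<alpha> where \<alpha>: "u c = Fin \<alpha>"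
    using vc.v_finite[OF assms] .
  have "\<phi> \<alpha> < \<phi> \<gamma>"
    by (simp add: \<phi>_const[OF \<alpha>] ident_\<gamma> less_prod_def)
  then have "\<alpha> < \<gamma>"
    using \<phi>_less_iff[of \<alpha> \<gamma>] value_group_UNIVI[OF \<alpha>] value_group_UNIVI[OF v_X_minus_a] by blast
  then show ?thesis
    by (simp add: \<alpha>)
qed

lemma v_X_minus:
  assumes "r \<noteq> a"
  shows "v (XX - cst r) = u (a - r)"
proof -
  have "v (cst (a - r)) < v (XX - cst a)"
    unfolding v_X_minus_a using assms by (intro const_less_\<gamma>) simp
  then have "v (cst (a - r) + (XX - cst a)) = v (cst (a - r))"
    by (rule vX.v_add_eq)
  moreover have "x - y + (z - x) = z - y" for x y z :: "'a poly fract"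
    by simp
  then have "cst (a - r) + (XX - cst a) = XX - cst r"
    unfolding cst_diff .
  ultimately show ?thesis
    by metis
qed

text \<open>A linear factor \<open>X - r\<close> has weight 1 under
  \<open>fst \<circ> \<phi>\<close> if \<open>r = a\<close>, and 0 otherwise, because its value is
  then that of the constant \<open>a - r\<close>. So the weight of \<open>p\<close> is the
  multiplicity of its root \<open>a\<close>.\<close>

lemma v_poly_weight:
  assumes "p \<noteq> 0"
  shows "\<exists>\<delta>. v (Fract p 1) = Fin \<delta> \<and> 0 \<le> fst (\<phi> \<delta>) \<and> (poly p a = 0 \<longrightarrow> 1 \<le> fst (\<phi> \<delta>))"
  using assms
proof (induction "Polynomial.degree p" arbitrary: p)
  case 0
  then obtain c where c: "p = [:c:]" "c \<noteq> 0"
    by (metis degree_eq_zeroE pCons_0_0)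
  then obtain \<alpha> where "u c = Fin \<alpha>"
    using vc.v_finite by metis
  then show ?case
    using c \<phi>_const by simp
next
  case (Suc n)
  then obtain r where "poly p r = 0"
    using alg_closed_imp_poly_has_root[of p] by auto
  then obtain q where q: "p = [:- r, 1:] * q"
    by (auto simp: poly_eq_0_iff_dvd)
  have "q \<noteq> 0"
    using Suc.prems q by auto
  then have "Polynomial.degree p = Suc (Polynomial.degree q)"
    unfolding q by (subst degree_mult_eq) auto
  then obtain \<delta> where \<delta>: "v (Fract q 1) = Fin \<delta>" "0 \<le> fst (\<phi> \<delta>)" "poly q a = 0 \<longrightarrow> 1 \<le> fst (\<phi> \<delta>)"
    using Suc.hyps \<open>q \<noteq> 0\<close> by (metis nat.inject)
  obtain \<epsilon> where \<epsilon>: "v (XX - cst r) = Fin \<epsilon>" "0 \<le> fst (\<phi> \<epsilon>)" "a = r \<longrightarrow> 1 \<le> fst (\<phi> \<epsilon>)"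
  proof (cases "r = a")
    case True
    then show thesis
      using that[of \<gamma>] v_X_minus_a ident_\<gamma> by simp
  next
    case False
    then have "a - r \<noteq> 0"
      by simp
    then obtain \<alpha> where \<alpha>: "u (a - r) = Fin \<alpha>"
      using vc.v_finite by blast
    show thesis
      using that[of \<alpha>] False v_X_minus[OF False] \<alpha> \<phi>_const[OF \<alpha>] by simp
  qed
  have "Fract p 1 = (XX - cst r) * Fract q 1"
    by (simp add: q)
  then have "v (Fract p 1) = Fin (\<epsilon> + \<delta>)"
    using \<delta> \<epsilon> by (simp only: vX.v_mult plus_extended.simps)
  moreover have "\<phi> (\<epsilon> + \<delta>) = \<phi> \<epsilon> + \<phi> \<delta>"
    using \<delta> \<epsilon> by (intro \<phi>_add value_group_UNIVI)
  ultimately show ?case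
    using \<delta> \<epsilon> by (auto simp: q)
qed

lemma const_less_v_poly:
  assumes "poly p a = 0" "c \<noteq> 0"
  shows "u c < v (Fract p 1)"
proof (cases "p = 0")
  case True
  then show ?thesis
    using vc.v_finite[OF assms(2)] by (metis fract_collapse(1) less_extended_simps(2) vX.v_0)
next
  case False
  then obtain \<delta> where \<delta>: "v (Fract p 1) = Fin \<delta>" "1 \<le> fst (\<phi> \<delta>)"
    using v_poly_weight assms by blast
  obtain \<alpha> where \<alpha>: "u c = Fin \<alpha>"
    using vc.v_finite[OF assms(2)] .
  have "\<phi> \<alpha> < \<phi> \<delta>"
    using \<delta>(2) by (simp add: \<phi>_const[OF \<alpha>] less_prod_def)
  then show ?thesis
    using \<alpha> \<delta> \<phi>_less_iff[OF value_group_UNIVI value_group_UNIVI, OF \<alpha> \<delta>(1)] by simp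
qed

text \<open>The difference of \<open>p(a)\<close> and \<open>p\<close> vanishes at \<open>a\<close>,
  so its value exceeds that of the nonzero constant \<open>p(a)\<close>.\<close>

lemma v_poly_eq:
  assumes "poly p a \<noteq> 0"
  shows "v (Fract p 1) = u (poly p a)"
proof -
  have "u (poly p a) < v (Fract ([:poly p a:] - p) 1)"
    using assms by (intro const_less_v_poly) auto
  also have "Fract ([:poly p a:] - p) 1 = cst (poly p a) - Fract p 1"
    by simp
  finally show ?thesis
    by (rule vX.v_eqI)
qed

text \<open>As \<open>X - a\<close> is infinitely small, \<open>p(X)/q(X)\<close> is infinitely close to \<open>p(a)/q(a)\<close>.\<close>

lemma const_less_v_ratfun_diff:
  assumes q: "poly q a \<noteq> 0" and "c \<noteq> 0"
  shows "u c < v (Fract p q - cst (poly p a / poly q a))"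
proof -
  let ?x = "poly p a" and ?y = "poly q a"
  have "q \<noteq> 0"
    using q by auto
  \<comment> \<open>\<open>N\<close> is the numerator of the difference over the common denominator
    \<open>?y * q\<close>, and it vanishes at \<open>a\<close>. That denominator has the value of
    \<open>?y * ?y\<close>, which explains the factor attached to \<open>c\<close> below.\<close>
  define N where "N = [:?y:] * p - [:?x:] * q"
  have "u (c * (?y * ?y)) < v (Fract N 1)"
    using assms by (intro const_less_v_poly) (simp_all add: N_def)
  moreover have "inverse (cst ?y * Fract q 1) \<noteq> 0"
    using q \<open>q \<noteq> 0\<close> by (simp add: Zero_fract_def eq_fract)
  ultimately have "v (cst (c * (?y * ?y)) * inverse (cst ?y * Fract q 1)) < v (Fract N 1 * inverse (cst ?y * Fract q 1))"
    by (rule vX.v_mult_less)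
  also have "Fract N 1 * inverse (cst ?y * Fract q 1) = Fract p q - cst (?x / ?y)"
  proof -
    have "Fract p q - cst (?x / ?y) = Fract p q - cst ?x * inverse (cst ?y)"
      by (simp only: divide_inverse cst_mult cst_inverse)
    also have "\<dots> = Fract N 1 * inverse (cst ?y * Fract q 1)"
      using q \<open>q \<noteq> 0\<close> by (simp add: N_def)
    finally show ?thesis
      by simp
  qed
  also have "v (cst (c * (?y * ?y)) * inverse (cst ?y * Fract q 1)) = u c"
  proof -
    obtain \<eta> where \<eta>: "u ?y = Fin \<eta>"
      using vc.v_finite[OF q] .
    have "v (Fract q 1) = Fin \<eta>"
      using v_poly_eq[OF q] \<eta> by simp
    then have "v (cst ?y * Fract q 1) = Fin (\<eta> + \<eta>)"
      using \<eta> by (simp only: vX.v_mult plus_extended.simps)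
    then have "v (inverse (cst ?y * Fract q 1)) = Fin (- (\<eta> + \<eta>))"
      by (rule vX.v_inverse)
    moreover have "v (cst (c * (?y * ?y))) = u c + Fin (\<eta> + \<eta>)"
      using \<eta> by (simp only: cst_mult vX.v_mult plus_extended.simps)
    ultimately show ?thesis
      unfolding vX.v_mult by (cases "u c") simp_all
  qed
  finally show ?thesis .
qed

section \<open>Value groups of \<open>K\<close> and \<open>K(X)\<close>, and the case of
  \<open>a\<close> algebraic over \<open>K\<close>\<close>

lemma torsion_const:
  assumes "g \<in> value_group (cst ` alg_cl K) v"
  shows "\<exists>n>0. (\<Sum>i<n::nat. g) \<in> value_group (cst ` K) v"
proof -
  obtain c where c: "c \<in> alg_cl K" "u c = Fin g"
    using assms by (auto simp: value_group_def)
  then have "c \<noteq> 0"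
    by (metis extended.distinct(1) vc.v_0)
  obtain n d where d: "n > 0" "d \<in> K" "d \<noteq> 0" "u (c ^ n) = u d"
    using vc.alg_cl_torsion[OF subfields(1) c(1) \<open>c \<noteq> 0\<close>] .
  then have "u d = Fin (\<Sum>i<n. g)"
    using vc.v_power[OF c(2)] by metis
  then show ?thesis
    using d(1,2) by (auto simp: value_group_def)
qed

lemma additive_subgroup_value_group_K: "additive_subgroup (value_group (cst ` K) v)"
proof -
  have "value_group (cst ` K) v = value_group K u"
    by (auto simp: value_group_def)
  then show ?thesis
    using vc.additive_subgroup_value_group[OF subfields(1)] by simp
qed

lemma cst_K_subset: "cst ` K \<subseteq> ratfuns K"
  using cst_in_ratfuns[OF subfields(1)] by blast

lemma value_group_K_subset: "value_group (cst ` K) v \<subseteq> value_group (ratfuns K) v"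
  using cst_K_subset by (auto simp: value_group_def)

lemma additive_subgroup_value_group_ratfuns: "additive_subgroup (value_group (ratfuns K) v)"
  by (rule vX.additive_subgroup_value_group[OF is_subfield_ratfuns[OF subfields(1)]])

text \<open>The dimension criterion is applied to \<open>fst \<circ> \<phi>\<close>. It is nonzero
  at the value of a polynomial over \<open>K\<close> that vanishes at \<open>a\<close>.\<close>

lemma value_transcendental_K:
  assumes "a \<in> alg_cl K"
  shows "value_transcendental K v"
proof -
  obtain p where p: "p \<noteq> 0" "\<forall>i. poly.coeff p i \<in> K" "poly p a = 0"
    using assms by (auto simp: alg_cl_def)
  obtain \<delta> where \<delta>: "v (Fract p 1) = Fin \<delta>" "1 \<le> fst (\<phi> \<delta>)"
    using v_poly_weight p by blast
  have "\<forall>i. poly.coeff 1 i \<in> K"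
    using is_subfieldD[OF subfields(1)] by simp
  moreover have "(1 :: 'a poly) \<noteq> 0"
    by simp
  ultimately have "Fract p 1 \<in> ratfuns K"
    unfolding ratfuns_def using p by blast
  then have "\<delta> \<in> value_group (ratfuns K) v"
    using \<delta> by (auto simp: value_group_def)
  have sub: "value_group (ratfuns K) v \<subseteq> value_group UNIV v"
    by (auto simp: value_group_def)
  show ?thesis
    unfolding value_transcendental_def
  proof (rule tensorQ_dim_eq_1_ModI[OF additive_subgroup_value_group_ratfuns additive_subgroup_value_group_K
        value_group_K_subset, of "\<lambda>g. fst (\<phi> g)" \<delta>])
    show "fst (\<phi> (x + y)) = fst (\<phi> x) + fst (\<phi> y)"
      if "x \<in> value_group (ratfuns K) v" "y \<in> value_group (ratfuns K) v" for x y
      using \<phi>_add[OF subsetD[OF sub] subsetD[OF sub], OF that] by simp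
    show "fst (\<phi> x) = 0" if "x \<in> value_group (cst ` K) v" for x
      using that \<phi>_const by (auto simp: value_group_def)
    show "\<exists>n>0. (\<Sum>i<n::nat. g) \<in> value_group (cst ` K) v"
      if g: "g \<in> value_group (ratfuns K) v" "fst (\<phi> g) = 0" for g
    proof (rule torsion_const)
      \<comment> \<open>A value of weight 0 has image \<open>(0, \<alpha>)\<close>, which is also
        the image of the constant value \<open>\<alpha>\<close>; injectivity of
        \<open>\<phi>\<close> identifies the two.\<close>
      have "\<phi> g \<in> UNIV \<times> value_group (cst ` alg_cl K) v"
        using ident g sub by (auto simp: ordered_group_iso_def bij_betw_def)
      then obtain \<alpha> where \<alpha>: "\<phi> g = (0, \<alpha>)" "\<alpha> \<in> value_group (cst ` alg_cl K) v"
        using g(2) by (cases "\<phi> g") auto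
      then have "\<phi> g = \<phi> \<alpha>" "\<alpha> \<in> value_group UNIV v"
        using ident_K by (auto simp: value_group_def)
      then have "g = \<alpha>"
        using ident g sub by (auto simp: ordered_group_iso_def bij_betw_def inj_on_def)
      then show "g \<in> value_group (cst ` alg_cl K) v"
        using \<alpha> by simp
    qed
  qed (use \<delta> \<open>\<delta> \<in> value_group (ratfuns K) v\<close> in auto)
qed

text \<open>For \<open>b \<noteq> a\<close>, an element \<open>d\<close> of \<open>alg_cl K\<close> close to \<open>b - a\<close> contradicts the formula for
  \<open>v (d + (X - b))\<close>; the detour through \<open>d\<close> avoids showing that \<open>alg_cl K\<close> is closed under subtraction.\<close>

lemma pair_of_definition_K_unique:
  assumes "pair_of_definition K v b \<beta>"
  shows "b = a" "\<beta> = \<gamma>"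
proof -
  have is_v': "is_v_a_gamma (alg_cl K) u b \<beta> v"
    using assms by (simp add: pair_of_definition_def)
  have K: "0 \<in> alg_cl K" "1 \<in> alg_cl K"
    using is_subfieldD(1,2)[OF subfields(1)] subset_alg_cl[OF subfields(1)] by auto
  have formula: "v (cst d + (XX - cst b)) = min (u d) (Fin \<beta>)" if "d \<in> alg_cl K" for d
    using is_v_a_gamma_linear[OF is_v' that K(2)] vc.v_1 by simp
  have \<beta>: "v (XX - cst b) = Fin \<beta>"
    using formula[OF K(1)] by (simp add: fract_collapse)
  show "b = a"
  proof (rule ccontr)
    assume "b \<noteq> a"
    then have "a - b \<noteq> 0" "b - a \<noteq> 0"
      by auto
    obtain d where d: "d \<in> alg_cl K" "u (b - a) < u (b - a - d)"
      using alg_cl_K_dense[OF \<open>b - a \<noteq> 0\<close>] .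
    have "u d = u (b - a)"
      using d(2) by (rule vc.v_eqI)
    \<comment> \<open>Both entries of the minimum in \<open>formula\<close> now equal
      \<open>u (b - a)\<close>. Yet \<open>d + (X - b)\<close> is the difference of
      \<open>X - a\<close> and \<open>b - a - d\<close>, both of greater value.\<close>
    then have "u d = Fin \<beta>"
      using \<beta> v_X_minus[OF \<open>b \<noteq> a\<close>] vc.v_diff_commute[of a b] by metis
    then have "v (cst d + (XX - cst b)) = u (b - a)"
      using formula[OF d(1)] \<open>u d = u (b - a)\<close> by simp
    moreover have "x + (y - z) = (y - t) - (z - t - x)" for x y z t :: "'a poly fract"
      by simp
    then have "cst d + (XX - cst b) = (XX - cst a) - cst (b - a - d)"
      unfolding cst_diff .
    moreover have "u (b - a) < v ((XX - cst a) - cst (b - a - d))"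
      by (rule vX.v_diff_less[OF const_less_\<gamma>[OF \<open>b - a \<noteq> 0\<close>, folded v_X_minus_a] d(2)])
    ultimately show False
      by (metis less_irrefl)
  qed
  then show "\<beta> = \<gamma>"
    using \<beta> v_X_minus_a by simp
qed

lemma pair_of_definition_K:
  assumes "a \<in> alg_cl K"
  shows "pair_of_definition K v a \<gamma>"
  unfolding pair_of_definition_def
proof (intro conjI assms)
  have K: "0 \<in> alg_cl K" "1 \<in> alg_cl K" "-1 \<in> alg_cl K"
    using is_subfieldD(1,2,5)[OF subfields(1)] subset_alg_cl[OF subfields(1)] by auto
  \<comment> \<open>The element \<open>a - X\<close> is used instead of \<open>X - a\<close> because
    its coefficients are visibly in \<open>alg_cl K\<close>, whereas \<open>- a\<close> would need
    closure under negation.\<close>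
  have "\<forall>i. poly.coeff [:a, -1:] i \<in> alg_cl K" "\<forall>i. poly.coeff 1 i \<in> alg_cl K"
    using K assms by (auto simp: coeff_pCons split: nat.splits)
  moreover have "(1 :: 'a poly) \<noteq> 0"
    by simp
  ultimately have "Fract [:a, -1:] 1 \<in> ratfuns (alg_cl K)"
    unfolding ratfuns_def by blast
  moreover have "Fract [:a, -1:] 1 = - (XX - cst a)"
    by simp
  then have "v (Fract [:a, -1:] 1) = Fin \<gamma>"
    by (simp only: vX.v_minus v_X_minus_a)
  ultimately show "\<gamma> \<in> value_group (ratfuns (alg_cl K)) v"
    by (auto simp: value_group_def)
  show "is_v_a_gamma (alg_cl K) u a \<gamma> v"
    using is_v unfolding is_v_a_gamma_def by (simp add: valuation_def)
qed

text \<open>The only pair of definition over \<open>K\<close> is the given pair over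
  \<open>Khat\<close>, so \<open>v\<close> itself is the constructed valuation.\<close>

lemma induced_by_transcendental_K:
  assumes "a \<in> alg_cl K"
  shows "induced_by_transcendental K Khat v"
  unfolding induced_by_transcendental_def
proof (intro conjI allI impI)
  show "\<exists>b \<beta>. pair_of_definition K v b \<beta>"
    using pair_of_definition_K[OF assms] by blast
next
  fix b \<beta>
  assume "pair_of_definition K v b \<beta>"
  then have "b = a" "\<beta> = \<gamma>"
    by (rule pair_of_definition_K_unique)+
  then have "is_v_a_gamma (alg_cl Khat) u b \<beta> v"
    using is_v closure by simp
  moreover have "equivalent_on (ratfuns Khat) v v"
    unfolding equivalent_on_def ordered_group_iso_def
    by (intro exI[of _ id]) (auto simp: strict_mono_on_def extended.map_id)
  ultimately show "\<exists>w. is_v_a_gamma (alg_cl Khat) u b \<beta> w \<and> equivalent_on (ratfuns Khat) v w"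
    by blast
qed

end

section \<open>The valuation algebraic case\<close>

lemma map_poly_cst_eval: "poly (map_poly (\<lambda>c. cst c) p) (cst x) = cst (poly p x)"
proof (induction p)
  case (pCons c p)
  have "map_poly (\<lambda>c. cst c) (pCons c p) = pCons (cst c) (map_poly (\<lambda>c. cst c) p)"
    using pCons.hyps by (intro map_poly_pCons) (simp add: fract_collapse)
  then show ?case
    unfolding poly_pCons cst_add cst_mult pCons.IH[symmetric] by (rule ssubst) (simp only: poly_pCons)
qed (simp add: fract_collapse)

context infinite_pair
begin

context
  assumes a: "a \<notin> alg_cl K"
begin

text \<open>The constant is \<open>f(a)\<close>. Since \<open>a\<close> is a root of no nonzero
  polynomial over \<open>K\<close>, the denominator does not vanish at \<open>a\<close>, and the
  numerator does so only if it is zero.\<close>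

lemma ratfun_close_to_const:
  assumes "f \<in> ratfuns K"
  obtains b where "b \<noteq> 0 \<longleftrightarrow> f \<noteq> 0" "\<And>c. c \<noteq> 0 \<Longrightarrow> u c < v (f - cst b)"
proof -
  obtain p q where pq: "f = Fract p q" "\<forall>i. poly.coeff p i \<in> K" "\<forall>i. poly.coeff q i \<in> K" "q \<noteq> 0"
    using assms unfolding ratfuns_def by blast
  have "poly q a \<noteq> 0"
    using a pq unfolding alg_cl_def by blast
  have "poly p a = 0 \<longleftrightarrow> p = 0"
    using a pq unfolding alg_cl_def by auto
  show thesis
  proof (rule that[of "poly p a / poly q a"])
    show "poly p a / poly q a \<noteq> 0 \<longleftrightarrow> f \<noteq> 0"
      using \<open>poly q a \<noteq> 0\<close> \<open>poly p a = 0 \<longleftrightarrow> p = 0\<close> pq(4) unfolding pq(1)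
      by (simp add: Zero_fract_def eq_fract)
    show "u c < v (f - cst (poly p a / poly q a))" if "c \<noteq> 0" for c
      unfolding pq(1) using \<open>poly q a \<noteq> 0\<close> that by (rule const_less_v_ratfun_diff)
  qed
qed

lemma v_X_minus_alg: "c \<in> alg_cl K \<Longrightarrow> v (XX - cst c) = u (a - c)"
  using v_X_minus a by metis

lemma not_value_transcendental_K: "\<not> value_transcendental K v"
  unfolding value_transcendental_def
proof (rule torsion_Mod_imp_not_tensorQ_dim_eq_1[OF additive_subgroup_value_group_ratfuns
      additive_subgroup_value_group_K value_group_K_subset])
  fix g
  assume "g \<in> value_group (ratfuns K) v"
  then obtain f where f: "f \<in> ratfuns K" "v f = Fin g"
    by (auto simp: value_group_def)
  obtain b where b: "b \<noteq> 0 \<longleftrightarrow> f \<noteq> 0" "\<And>c. c \<noteq> 0 \<Longrightarrow> u c < v (f - cst b)"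
    using ratfun_close_to_const[OF f(1)] by blast
  have "b \<noteq> 0"
    using b(1) f(2) by auto
  then have "u b < v (cst b - f)"
    using b(2) vX.v_diff_commute by metis
  then have "u b = Fin g"
    using vX.v_eqI f(2) by metis
  then show "\<exists>n>0. (\<Sum>i<n::nat. g) \<in> value_group (cst ` K) v"
    by (intro torsion_const value_group_const)
qed

text \<open>Modulo the valuation ideal, \<open>f\<close> is congruent to the constant
  \<open>f(a)\<close>, which by density is congruent to some \<open>c\<close> in
  \<open>alg_cl K\<close>. A normalized polynomial over \<open>K\<close> vanishing at
  \<open>c\<close> therefore takes a value in the ideal at \<open>f\<close>.\<close>

lemma not_residue_transcendental_K: "\<not> residue_transcendental K v"
  unfolding residue_transcendental_def
proof (rule vX.residue_not_trdeg_eq_1[OF is_subfield_ratfuns[OF subfields(1)] cst_K_subset])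
  fix f
  assume f: "f \<in> ratfuns K" "0 \<le> v f"
  obtain b where b: "\<And>c. c \<noteq> 0 \<Longrightarrow> u c < v (f - cst b)"
    using ratfun_close_to_const[OF f(1)] by blast
  obtain c where c: "c \<in> alg_cl K" "u 1 < u (b - c)"
    using alg_cl_K_dense[of 1 b] by auto
  have u1: "u 1 = 0"
    by (rule vc.v_1)
  have "u 1 < v ((f - cst b) + cst (b - c))"
    using b[of 1] c(2) by (intro vX.v_add_less) simp_all
  moreover have "(x - y) + (y - z) = x - z" for x y z :: "'a poly fract"
    by simp
  ultimately have fc: "0 < v (f - cst c)"
    unfolding u1 cst_diff by metis
  then have "0 \<le> v (cst c)"
    using vX.v_nonneg_add[of f "- (f - cst c)"] f(2) unfolding vX.v_minus by (simp add: less_imp_le)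
  obtain p i where p: "\<And>i. poly.coeff p i \<in> K" "poly p c = 0" "\<And>i. 0 \<le> u (poly.coeff p i)"
    "u (poly.coeff p i) = 0"
    using vc.alg_cl_normalized[OF subfields(1) c(1)] by blast
  define P where "P = map_poly (\<lambda>c. cst c) p"
  have coeff_P: "poly.coeff P i = cst (poly.coeff p i)" for i
    unfolding P_def by (rule coeff_map_poly) (simp add: fract_collapse)
  have "poly P (cst c) = 0"
    unfolding P_def map_poly_cst_eval p(2) by (simp add: fract_collapse)
  then have "0 < v (poly P f)"
    using f(2) \<open>0 \<le> v (cst c)\<close> fc p(3) by (intro vX.v_poly_pos[of f "cst c" P]) (simp_all only: coeff_P)
  then show "\<exists>P. (\<forall>i. poly.coeff P i \<in> cst ` K \<and> 0 \<le> v (poly.coeff P i)) \<and>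
      (\<exists>i. v (poly.coeff P i) = 0) \<and> 0 < v (poly P f)"
    using p by (intro exI[of _ P]) (auto simp only: coeff_P)
qed

lemma valuation_algebraic_K: "valuation_algebraic K v"
  using not_value_transcendental_K not_residue_transcendental_K
  by (simp add: valuation_algebraic_def valuation_transcendental_def)

text \<open>\<open>g\<close> is cofinal only in the values \<open>v (X - b)\<close>. These equal
  \<open>u (a - b)\<close>, and density of \<open>alg_cl K\<close> makes them exceed every value of
  a nonzero constant.\<close>

lemma approximates_X_cofinal:
  assumes "approximates_X I K v g z" "c \<noteq> 0"
  obtains i where "i \<in> I" "u c < g i"
proof -
  obtain b where b: "b \<in> alg_cl K" "u c < u (a - b)"
    using alg_cl_K_dense[OF assms(2)] .
  then obtain i where "i \<in> I" "v (XX - cst b) \<le> g i"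
    using assms(1) unfolding approximates_X_def by blast
  then show thesis
    using that b v_X_minus_alg by (metis less_le_trans)
qed

text \<open>Both \<open>z i\<close> and \<open>z j\<close> approximate \<open>a\<close>, and
  \<open>z j\<close> does so strictly better; the difference inherits the smaller value.\<close>

lemma approximates_X_differences:
  assumes "approximates_X I K v g z" "i \<in> I" "j \<in> I" "i < j"
  shows "u (z i - z j) = g i"
proof -
  have g: "u (a - z i) = g i" "u (a - z j) = g j"
    using assms v_X_minus_alg unfolding approximates_X_def by metis+
  moreover have "g i < g j"
    using assms by (auto simp: approximates_X_def strict_mono_on_def)
  ultimately have "u (a - z i) < u (- (a - z j))"
    by (simp only: vc.v_minus)
  then have "u ((a - z i) + - (a - z j)) = u (a - z i)"
    by (rule vc.v_add_eq)
  moreover have "(a - z i) + - (a - z j) = - (z i - z j)"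
    by simp
  ultimately show ?thesis
    using g by (simp only: vc.v_minus)
qed

lemma approximates_X_next:
  assumes "approximates_X I K v g z" "i \<in> I"
  shows "u (z i - z (next_index I i)) = g i"
  using assms limit_index_next[of I i] approximates_X_differences[of I g z i]
  by (simp add: approximates_X_def)

text \<open>Two limits would differ by an element whose value is at least every \<open>g i\<close>,
  and \<open>g\<close> exceeds the value of every nonzero constant. This selects the branch with a
  limit in the construction and fixes the limit as \<open>a\<close>.\<close>

lemma approximates_X_pseudo_limit_iff:
  assumes "approximates_X I K v g z"
  shows "pseudo_limit I u z b \<longleftrightarrow> b = a"
proof
  assume b: "pseudo_limit I u z b"
  show "b = a"
  proof (rule ccontr)
    assume "b \<noteq> a"
    then have "b - a \<noteq> 0"
      by simp
    obtain i where i: "i \<in> I" "u (b - a) < g i"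
      using approximates_X_cofinal[OF assms \<open>b - a \<noteq> 0\<close>] .
    have "u (b - z i) = g i" "u (a - z i) = g i"
      using b i approximates_X_next[OF assms i(1)] v_X_minus_alg assms
      unfolding pseudo_limit_def approximates_X_def by metis+
    then have "u (b - a) < u (b - z i)" "u (b - a) < u (a - z i)"
      using i(2) by metis+
    then have "u (b - a) < u ((b - z i) - (a - z i))"
      by (rule vc.v_diff_less)
    moreover have "(b - z i) - (a - z i) = b - a"
      by simp
    ultimately show False
      by (metis less_irrefl)
  qed
next
  assume "b = a"
  then show "pseudo_limit I u z b"
    using approximates_X_next[OF assms] v_X_minus_alg assms
    unfolding pseudo_limit_def approximates_X_def by metis
qed

lemma approximates_X_Cauchy_sequence:
  assumes "approximates_X I K v g z"
  shows "Cauchy_sequence I (alg_cl K) u z"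
  unfolding Cauchy_sequence_def pseudo_Cauchy_def
proof (intro conjI ballI impI)
  show "z i \<in> alg_cl K" if "i \<in> I" for i
    using assms that by (simp add: approximates_X_def)
next
  fix i j k
  assume "i \<in> I" "j \<in> I" "k \<in> I" "i < j \<and> j < k"
  then show "u (z i - z j) < u (z j - z k)"
    using approximates_X_differences[OF assms] assms
    by (simp add: approximates_X_def strict_mono_on_def)
next
  fix \<delta>
  assume "\<delta> \<in> value_group (alg_cl K) u"
  then obtain c where "u c = Fin \<delta>"
    by (auto simp: value_group_def)
  moreover from this have "c \<noteq> 0"
    by (metis extended.distinct(1) vc.v_0)
  ultimately show "\<exists>i\<in>I. Fin \<delta> \<le> u (z i - z (next_index I i))"
    using approximates_X_cofinal[OF assms] approximates_X_next[OF assms] by (metis less_imp_le)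
qed

lemma approximates_X_exists: "\<exists>(I :: 'g set) g z. approximates_X I K v g z"
proof -
  let ?S = "{\<delta>. \<exists>c\<in>alg_cl K. v (XX - cst c) = Fin \<delta>}"
  have fin: "\<exists>\<delta>. v (XX - cst c) = Fin \<delta>" if "c \<in> alg_cl K" for c
  proof -
    have "a - c \<noteq> 0"
      using a that by auto
    then show ?thesis
      using v_X_minus_alg[OF that] vc.v_finite by metis
  qed
  have "0 \<in> alg_cl K"
    using is_subfieldD(1)[OF subfields(1)] subset_alg_cl[OF subfields(1)] by auto
  then have "?S \<noteq> {}"
    using fin by blast
  \<comment> \<open>There is no best approximant: \<open>a\<close> is not in
    \<open>alg_cl K\<close>, so \<open>a - c\<close> is nonzero and density improves on
    \<open>c\<close>.\<close>
  moreover have "\<exists>y\<in>?S. x < y" if x: "x \<in> ?S" for x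
  proof -
    obtain c where c: "c \<in> alg_cl K" "v (XX - cst c) = Fin x"
      using x by blast
    then have "u (a - c) = Fin x" "a - c \<noteq> 0"
      using v_X_minus_alg a by auto
    then obtain b where b: "b \<in> alg_cl K" "Fin x < u (a - b)"
      using alg_cl_K_dense[of "a - c" a] by metis
    obtain y where y: "v (XX - cst b) = Fin y"
      using fin[OF b(1)] by blast
    then have "Fin x < Fin y"
      using b(2) v_X_minus_alg[OF b(1)] by metis
    then show ?thesis
      using b(1) y by auto
  qed
  ultimately obtain I where I: "limit_index I" "I \<subseteq> ?S" "\<And>x. x \<in> ?S \<Longrightarrow> \<exists>i\<in>I. x \<le> i"
    by (rule exists_cofinal_limit_index) blast+
  have "\<forall>i\<in>I. \<exists>c. c \<in> alg_cl K \<and> v (XX - cst c) = Fin i"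
    using I(2) by blast
  from bchoice[OF this] obtain z where z: "\<forall>i\<in>I. z i \<in> alg_cl K \<and> v (XX - cst (z i)) = Fin i"
    by blast
  have "\<exists>i\<in>I. v (XX - cst c) \<le> Fin i" if c: "c \<in> alg_cl K" for c
  proof -
    obtain \<delta> where "v (XX - cst c) = Fin \<delta>"
      using fin[OF c] by blast
    moreover from this obtain i where "i \<in> I" "\<delta> \<le> i"
      using I(3)[of \<delta>] c by blast
    ultimately show ?thesis
      by (metis less_eq_extended.simps(1))
  qed
  \<comment> \<open>The sequence of values is indexed by itself, so \<open>g\<close> is just
    \<open>Fin\<close>.\<close>
  then have "approximates_X I K v Fin z"
    unfolding approximates_X_def using I(1) z by (auto simp: strict_mono_on_def)
  then show ?thesis
    by blast
qed

end

text \<open>This is \<open>v\<close> after the identification of its value group, the candidate for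
  the constructed valuation with pair \<open>(a, (1, 0))\<close>.\<close>

abbreviation "w x \<equiv> map_extended \<phi> (v x)"

lemma \<phi>_le: "\<alpha> \<in> value_group UNIV v \<Longrightarrow> \<beta> \<in> value_group UNIV v \<Longrightarrow> \<alpha> \<le> \<beta> \<Longrightarrow> \<phi> \<alpha> \<le> \<phi> \<beta>"
  using \<phi>_less_iff by (auto simp: le_less)

lemma w_mono:
  assumes "v x \<le> v y"
  shows "w x \<le> w y"
proof (cases "v x"; cases "v y")
  fix \<alpha> \<beta>
  assume "v x = Fin \<alpha>" "v y = Fin \<beta>"
  then show ?thesis
    using assms \<phi>_le[OF value_group_UNIVI value_group_UNIVI, of x \<alpha> y \<beta>] by simp
qed (use assms in auto)

lemma w_mult: "w (x * y) = w x + w y"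
proof (cases "v x"; cases "v y")
  fix \<alpha> \<beta>
  assume "v x = Fin \<alpha>" "v y = Fin \<beta>"
  then show ?thesis
    using \<phi>_add[OF value_group_UNIVI value_group_UNIVI, of x \<alpha> y \<beta>] by (simp add: vX.v_mult)
qed (auto simp: vX.v_mult)

lemma valuation_w: "valuation (ring_on UNIV) w"
  unfolding valuation_def ring_on_simps
proof (intro conjI ballI)
  fix x y
  show "w x \<noteq> Minf"
    using vX.v_neq_Minf(1)[of x] by (cases "v x") auto
  show "w x = Pinf \<longleftrightarrow> x = 0"
    using vX.v_eq_Pinf_iff(1)[of x] by (cases "v x") auto
  show "w (x * y) = w x + w y"
    by (rule w_mult)
  have "v x \<le> v (x + y) \<or> v y \<le> v (x + y)"
    using vX.v_add[of x y] by (auto simp: min_def split: if_splits)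
  then show "min (w x) (w y) \<le> w (x + y)"
    using w_mono by (metis min.coboundedI1 min.coboundedI2)
qed

text \<open>Being monotone, \<open>\<phi>\<close> commutes with minima: a term of least value for
  \<open>v\<close> is one for \<open>w\<close>. On single terms, \<open>\<phi>\<close> sends a
  constant value \<open>\<alpha>\<close> to \<open>(0, \<alpha>)\<close> and \<open>\<gamma>\<close>
  to \<open>(1, 0)\<close>.\<close>

lemma w_pair: "is_v_a_gamma UNIV (\<lambda>c. map_extended (\<lambda>\<alpha>. (0, \<alpha>)) (u c)) a (1, 0) w"
  unfolding is_v_a_gamma_def
proof (intro conjI allI impI)
  show "valuation (ring_on (ratfuns UNIV)) w"
    using valuation_w by simp
next
  fix n :: nat and C :: "nat \<Rightarrow> 'a"
  define t where "t i = cst (C i) * (XX - cst a) ^ i" for i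
  have pow: "v ((XX - cst a) ^ i) = Fin (\<Sum>j<i. \<gamma>)" for i
    by (rule vX.v_power[OF v_X_minus_a])
  have t: "v (t i) = u (C i) + Fin (\<Sum>j<i. \<gamma>)" for i
    unfolding t_def vX.v_mult pow ..
  have w_pow: "w ((XX - cst a) ^ i) = Fin (\<Sum>j<i. (1, 0))" for i
  proof (induction i)
    case 0
    have "\<phi> 0 = (0, 0)"
      using \<phi>_const[of 1 0] vc.v_1 by (simp add: zero_extended_def)
    then show ?case
      using pow[of 0] by (simp add: zero_prod_def zero_extended_def)
  next
    case (Suc i)
    have "w ((XX - cst a) ^ Suc i) = w (XX - cst a) + w ((XX - cst a) ^ i)"
      unfolding power_Suc by (rule w_mult)
    also have "\<dots> = Fin (\<Sum>j<Suc i. (1, 0))"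
      unfolding Suc.IH v_X_minus_a by (simp add: ident_\<gamma> add.commute)
    finally show ?case .
  qed
  have w_t: "w (t i) = map_extended (\<lambda>\<alpha>. (0, \<alpha>)) (u (C i)) + Fin (\<Sum>j<i. (1, 0))" for i
  proof -
    have "w (t i) = w (cst (C i)) + Fin (\<Sum>j<i. (1, 0))"
      unfolding t_def w_mult w_pow ..
    moreover have "w (cst (C i)) = map_extended (\<lambda>\<alpha>. (0, \<alpha>)) (u (C i))"
      using \<phi>_const[of "C i"] by (cases "u (C i)") simp_all
    ultimately show ?thesis
      by simp
  qed
  have sum: "v (\<Sum>i\<le>n. t i) = Min ((\<lambda>i. v (t i)) ` {..n})"
    unfolding t unfolding t_def using is_v unfolding is_v_a_gamma_def by blast
  have "Min ((\<lambda>i. v (t i)) ` {..n}) \<in> (\<lambda>i. v (t i)) ` {..n}"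
    by (rule Min_in) auto
  then obtain k where k: "Min ((\<lambda>i. v (t i)) ` {..n}) = v (t k)" "k \<in> {..n}"
    by (rule imageE)
  have "v (t k) \<le> v (t i)" if "i \<le> n" for i
    unfolding k(1)[symmetric] using that by (intro Min_le) auto
  then have "Min ((\<lambda>i. w (t i)) ` {..n}) = w (t k)"
    using k(2) w_mono by (intro Min_eqI) auto
  then have "w (\<Sum>i\<le>n. t i) = Min ((\<lambda>i. w (t i)) ` {..n})"
    unfolding sum k(1) by (rule sym)
  then show "w (\<Sum>i\<le>n. cst (C i) * (XX - cst a) ^ i) =
      Min ((\<lambda>i. map_extended (\<lambda>\<alpha>. (0, \<alpha>)) (u (C i)) + Fin (\<Sum>j<i. (1, 0))) ` {..n})"
    unfolding w_t unfolding t_def .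
qed

lemma equivalent_on_w: "equivalent_on F v w"
  unfolding equivalent_on_def
proof (intro exI[of _ \<phi>] conjI)
  have sub: "value_group F v \<subseteq> value_group UNIV v"
    by (auto simp: value_group_def)
  have image: "value_group F w = \<phi> ` value_group F v"
  proof (intro equalityI subsetI)
    fix \<beta>
    assume "\<beta> \<in> value_group F w"
    then obtain x where x: "x \<in> F" "w x = Fin \<beta>"
      by (auto simp: value_group_def)
    then show "\<beta> \<in> \<phi> ` value_group F v"
      by (cases "v x") (auto simp: value_group_def)
  next
    fix \<beta>
    assume "\<beta> \<in> \<phi> ` value_group F v"
    then show "\<beta> \<in> value_group F w"
      unfolding value_group_def by force
  qed
  show "ordered_group_iso \<phi> (value_group F v) (value_group F w)"
    unfolding ordered_group_iso_def image
  proof (intro conjI ballI)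
    show "bij_betw \<phi> (value_group F v) (\<phi> ` value_group F v)"
      using ident sub by (auto simp: ordered_group_iso_def bij_betw_def intro: inj_on_subset)
    show "\<phi> (x + y) = \<phi> x + \<phi> y" if "x \<in> value_group F v" "y \<in> value_group F v" for x y
      by (rule \<phi>_add[OF subsetD[OF sub] subsetD[OF sub], OF that])
    show "strict_mono_on (value_group F v) \<phi>"
      using ident sub unfolding ordered_group_iso_def strict_mono_on_def by blast
  qed
qed auto

lemma induced_by_algebraic_K:
  assumes "a \<notin> alg_cl K"
  shows "induced_by_algebraic K Khat v"
  unfolding induced_by_algebraic_def
proof (intro conjI allI impI)
  show "\<exists>(I :: 'g set) g z. approximates_X I K v g z"
    by (rule approximates_X_exists[OF assms])
next
  fix I :: "'g set" and g z
  assume "approximates_X I K v g z"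
  then have lim: "pseudo_limit I u z b \<longleftrightarrow> b = a" for b
    by (rule approximates_X_pseudo_limit_iff[OF assms])
  have "\<exists>w :: 'a poly fract \<Rightarrow> (int \<times> 'g) extended.
      is_v_a_gamma (alg_cl Khat) (\<lambda>c. map_extended (\<lambda>\<alpha>. (0, \<alpha>)) (u c)) a (1, 0) w \<and>
      equivalent_on (ratfuns Khat) v w"
    unfolding closure using w_pair equivalent_on_w by blast
  then show "if \<exists>b\<in>alg_cl Khat. pseudo_limit I u z b
      then \<forall>b\<in>alg_cl Khat. pseudo_limit I u z b \<longrightarrow>
        (\<exists>w :: 'a poly fract \<Rightarrow> (int \<times> 'g) extended.
          is_v_a_gamma (alg_cl Khat) (\<lambda>c. map_extended (\<lambda>\<alpha>. (0, \<alpha>)) (u c)) b (1, 0) w \<and>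
          equivalent_on (ratfuns Khat) v w)
      else \<exists>w :: 'a poly fract \<Rightarrow> 'g extended.
        valuation (ring_on (ratfuns (alg_cl Khat))) w \<and>
        (\<forall>c\<in>alg_cl Khat. w (cst c) = u c) \<and>
        pseudo_limit I w (\<lambda>i. cst (z i)) XX \<and>
        equivalent_on (ratfuns Khat) v w"
    unfolding lim by (simp add: closure)
qed

end

theorem proposition4p3:
  fixes v :: "'a::alg_closed_field poly fract \<Rightarrow> 'g::linordered_ab_group_add extended"
    and K Khat :: "'a set"
    and a :: 'a and \<gamma> :: 'g
    and \<phi> :: "'g \<Rightarrow> int \<times> 'g"
  assumes closure: "alg_cl Khat = UNIV"
    and val: "valuation (ring_on UNIV) v"
    and completion: "is_completion K Khat (\<lambda>c. v (cst c))"
    and transc: "valuation_transcendental Khat v"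
    and pair: "pair_of_definition Khat v a \<gamma>"
    and pair_unique: "\<And>b \<beta>. pair_of_definition Khat v b \<beta> \<Longrightarrow> b = a \<and> \<beta> = \<gamma>"
    and ident: "ordered_group_iso \<phi> (value_group UNIV v) (UNIV \<times> value_group (cst ` alg_cl K) v)"
    and ident_\<gamma>: "\<phi> \<gamma> = (1, 0)"
    and ident_K: "\<And>\<alpha>. \<alpha> \<in> value_group (cst ` alg_cl K) v \<Longrightarrow> \<phi> \<alpha> = (0, \<alpha>)"
  shows "(a \<in> alg_cl K \<longrightarrow> valuation_transcendental K v \<and> induced K Khat v) \<and>
    (a \<notin> alg_cl K \<longrightarrow>
       valuation_algebraic K v \<and> induced K Khat v \<and>
       (\<forall>(I :: 'i::linorder set) g z. approximates_X I K v g z \<longrightarrow>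
          Cauchy_sequence I (alg_cl K) (\<lambda>c. v (cst c)) z \<and>
          pseudo_limit I (\<lambda>c. v (cst c)) z a))"
proof -
  interpret infinite_pair v K Khat a \<gamma> \<phi>
    using closure val completion pair ident ident_\<gamma> ident_K
    by unfold_locales (simp_all add: is_completion_def)
  show ?thesis
  proof (intro conjI impI allI)
    assume "a \<in> alg_cl K"
    \<comment> \<open>\<open>induced\<close> branches on
      \<open>valuation_transcendental K v\<close>, so the first claim decides which construction the
      second has to match.\<close>
    then show "valuation_transcendental K v" "induced K Khat v"
      using value_transcendental_K induced_by_transcendental_K
      by (simp_all add: valuation_transcendental_def induced_def)
  next
    assume a: "a \<notin> alg_cl K"
    then show "valuation_algebraic K v" "induced K Khat v"
      using valuation_algebraic_K induced_by_algebraic_K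
      by (simp_all add: valuation_algebraic_def induced_def)
    show "Cauchy_sequence I (alg_cl K) (\<lambda>c. v (cst c)) z" "pseudo_limit I (\<lambda>c. v (cst c)) z a"
      if "approximates_X I K v g z" for I :: "'i set" and g z
      using approximates_X_Cauchy_sequence[OF a that] approximates_X_pseudo_limit_iff[OF a that] by auto
  qed
qed

end
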